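(* Let $\mathcal N_1$ and $\mathcal N_2$ be two regular (identical-edge) coupled cell networks with the same cell-type and the same edge-type, with disjoint cell sets $\mathcal C_1$ and $\mathcal C_2$, and with valencies $v_1$ and $v_2$, respectively. Let $\mathcal N=\mathcal N_1+\mathcal N_2$ be their disjoint union. (a) If $v_1\neq v_2$ then $V_{\mathcal N}=V^{nb}_{\mathcal N}$. (b) If $v_1=v_2$ then $V_{\mathcal N}=V^{nb}_{\mathcal N}\cup V^{pb}_{\mathcal N}\cup V^{npb}_{\mathcal N}$. Moreover: (i) $\Delta_{\bowtie}\in V^{nb}_{\mathcal N}$ if and only if $\Delta_{\bowtie}=\Delta_{\bowtie_1}\,\dot\cap\,\Delta_{\bowtie_2}$ for some $\Delta_{\bowtie_i}\in V_{\mathcal N_i}$, $i=1,2$. (ii) For $\Delta_{\bowtie}=\{x:\ x_{c_i}=x_{d_i},\ i=1,\dots,m\}$, where $c_1,\dots,c_m\in\mathcal C_1$ are distinct and $d_1,\dots,d_m\in\mathcal C_2$ are distinct, one has $\Delta_{\bowtie}\in V^{pb}_{\mathcal N}$ if and only if the permutation of $\mathcal C_1\cup\mathcal C_2$ given by the product of the disjoint transpositions $(c_i\ d_i)$, $i=1,\dots,m$, is an interior symmetry of $\mathcal N$ on $\{c_1,d_1,\dots,c_m,d_m\}$. (iii) $\Delta_{\bowtie}\in V^{npb}_{\mathcal N}$ if and only if $\Delta_{\bowtie}=L(\Delta_{\bowtie_Q})$ for some $\Delta_{\bowtie_Q}\in V^{pb}_{Q}$, where $Q$ is the quotient network of $\mathcal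 N$ associated to a nontrivial $\Delta_{\tilde\bowtie}\in V^{nb}_{\mathcal N}$ such that $\Delta_{\bowtie}\subset\Delta_{\tilde\bowtie}$, and $L$ is the lift associated to $\Delta_{\tilde\bowtie}$.
   Context: Networks. A coupled cell network is a finite directed graph (multiple edges and self-loops allowed) whose vertices are called cells, together with an equivalence relation on cells (cell-types) and one on edges (edge-types) such that equivalent edges have equivalent heads and equivalent tails. A regular (identical-edge) network has a single cell-type and a single edge-type, and every cell receives the same number $v$ of input edges; $v$ is the valency. Networks are finite and, unless they arise as disjoint unions, connected. The adjacency matrix of a network with a single edge-type is $A=(a_{cd})$, with $a_{cd}$ the number of edges from cell $d$ to cell $c$. The disjoint union $\mathcal N=\mathcal N_1+\mathcal N_2$ has cell set $\mathcal C_1\cup\mathcal C_2$ (all cells of one type) and as edges all edges of $\mathcal N_1$ and $\mathcal N_2$ (all of one edge-type). Synchrony subspaces. Each cell $c$ has the same phase space $\mathbb R^k$; the total phase space $P$ is the product over all cells, with coordinates $x=(x_c)$. A polydiagonal subspace is a subspace $\Delta_{\bowtie}=\{x\in P:\ x_c=x_d \text{ whenever } c\bowtie d\}$ for an equivalence relation $\bowtie$ on cells. A synchrony subspace is a polydiagonal subspace that is flow-invariant under all admissible vector fields of the network, i.e. smooth vector fields $\dot x_c=f_c(x_c;x_{i_1},\dots,x_{i_v})$, where $i_1,\dots,i_v$ are the tail cells of the edges into $c$ (with multiplicity), $f_c$ is symmetric in the variables corresponding to edges of the same type, and cells of the same type with the same valency share the same function $f$. Equivalently, $\bowtie$ is balanced: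 whenever $c\bowtie d$ there is an edge-type preserving bijection from the input edges of $c$ to the input edges of $d$ sending each input edge to one whose tail is in the same $\bowtie$-class. $V_{\mathcal N}$ denotes the set (lattice under inclusion) of all synchrony subspaces of $\mathcal N$, including $P$ itself. A synchrony subspace is nontrivial if it is not the whole total phase space. Types of synchrony subspaces for a disjoint union $\mathcal N=\mathcal N_1+\mathcal N_2$. $\Delta_{\bowtie}\in V_{\mathcal N}$ is bipartite if its definition contains at least one coordinate equality condition $x_{c_1}=\cdots=x_{c_m}$ with $\{c_1,\dots,c_m\}\cap\mathcal C_1\neq\emptyset$ and $\{c_1,\dots,c_m\}\cap\mathcal C_2\neq\emptyset$; otherwise it is non-bipartite. A bipartite $\Delta_{\bowtie}$ is pairing if every equality condition in it is of the form $x_{c_1}=x_{c_2}$ with $c_1\in\mathcal C_1$, $c_2\in\mathcal C_2$, and there is no other cell $c_3$ with $x_{c_1}=x_{c_2}=x_{c_3}$ (i.e. each nontrivial $\bowtie$-class consists of exactly one cell of $\mathcal C_1$ and one cell of $\mathcal C_2$); otherwise it is non-pairing. $V^{nb}_{\mathcal N}$, $V^{pb}_{\mathcal N}$, $V^{npb}_{\mathcal N}$ denote the sets of non-bipartite, pairing bipartite and non-pairing bipartite synchrony subspaces of $\mathcal N$. Extended intersection. For $\Delta_{\bowtie_i}\in V_{\mathcal N_i}$ let $\Delta_{\bowtie_{E_i}}$ be the polydiagonal subspace of the total phase space of $\mathcal N$ defined by the same equality conditions as $\Delta_{\bowtie_i}$. Set $\Delta_{\bowtie_1}\,\dot\cap\,\Delta_{\bowtie_2}:=\Delta_{\bowtie_{E_1}}\cap\Delta_{\bowtie_{E_2}}$.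 Interior symmetry. For a network with a single edge-type, cell set $\mathcal C$ and adjacency matrix $(a_{cd})$, and $S\subseteq\mathcal C$, an interior symmetry on $S$ is a permutation $\sigma$ of $\mathcal C$ fixing every element of $\mathcal C\setminus S$ and satisfying $a_{cd}=a_{\sigma(c)\sigma(d)}$ for all $c\in S$, $d\in\mathcal C$. Quotient and lift. Given a synchrony subspace $\Delta_{\tilde\bowtie}$ of $\mathcal N$, the associated quotient network $Q$ has as cells the $\tilde\bowtie$-classes, and the number of edges from class $\bar d$ to class $\bar c$ is the number of edges into $c$ with tail in $\bar d$, for any representative $c$ of $\bar c$ (well defined since $\tilde\bowtie$ is balanced). When $\Delta_{\tilde\bowtie}$ is non-bipartite, $Q=Q_1+Q_2$ with $Q_i$ a quotient of $\mathcal N_i$, and $V^{pb}_Q$ is taken with respect to this decomposition. For a synchrony subspace $\Delta_{\bowtie_Q}$ of $Q$, its lift $L(\Delta_{\bowtie_Q})$ is the polydiagonal subspace of the phase space of $\mathcal N$ defined by the equalities defining $\Delta_{\tilde\bowtie}$ together with those defining $\Delta_{\bowtie_Q}$, where the coordinate of each class is replaced by the coordinate of any cell in that class. *)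

theory Defs
  imports
    "HOL-Analysis.Analysis"
    "HOL-Combinatorics.Permutations"
    "Graph_Theory.Digraph_Component"
begin

section \<open>Coupled cell networks\<close>

text \<open>
  The underlying graph is a multidigraph of the library; an edge \<open>e\<close> goes from \<open>tail e\<close>
  to \<open>head e\<close>, so the input edges of a cell \<open>c\<close> are \<open>in_arcs _ c\<close>. The two type relations
  are the equivalence relations on cells and on edges.
\<close>

record ('a, 'b) network =
  digr :: "('a, 'b) pre_digraph"
  cell_type :: "'a rel"
  edge_type :: "'b rel"

abbreviation cells :: "('a, 'b) network \<Rightarrow> 'a set" where
  "cells N \<equiv> verts (digr N)"

abbreviation edges :: "('a, 'b) network \<Rightarrow> 'b set" where
  "edges N \<equiv> arcs (digr N)"

abbreviation tail_cell :: "('a, 'b) network \<Rightarrow> 'b \<Rightarrow> 'a" where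
  "tail_cell N \<equiv> tail (digr N)"

abbreviation head_cell :: "('a, 'b) network \<Rightarrow> 'b \<Rightarrow> 'a" where
  "head_cell N \<equiv> head (digr N)"

abbreviation input_edges :: "('a, 'b) network \<Rightarrow> 'a \<Rightarrow> 'b set" where
  "input_edges N c \<equiv> in_arcs (digr N) c"

definition coupled_cell_network :: "('a, 'b) network \<Rightarrow> bool" where
  "coupled_cell_network N \<longleftrightarrow>
     fin_digraph (digr N) \<and> equiv (cells N) (cell_type N) \<and> equiv (edges N) (edge_type N) \<and>
     (\<forall>(e, e') \<in> edge_type N.
        (head_cell N e, head_cell N e') \<in> cell_type N \<and>
        (tail_cell N e, tail_cell N e') \<in> cell_type N)"

text \<open>
  Connectedness (in the undirected sense; it includes that there is at least one cell) is part
  of this definition, since it is a standing assumption on all networks except disjoint unions.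
\<close>

definition regular_network :: "('a, 'b) network \<Rightarrow> nat \<Rightarrow> bool" where
  "regular_network N v \<longleftrightarrow>
     coupled_cell_network N \<and> Digraph_Component.connected (digr N) \<and>
     cell_type N = cells N \<times> cells N \<and> edge_type N = edges N \<times> edges N \<and>
     (\<forall>c \<in> cells N. in_degree (digr N) c = v)"

definition adjacency :: "('a, 'b) network \<Rightarrow> 'a \<Rightarrow> 'a \<Rightarrow> nat" where
  "adjacency N c d = card {e \<in> edges N. tail_cell N e = d \<and> head_cell N e = c}"

text \<open>
  The cell sets are meant to be disjoint; the edge sets are made disjoint by the sum type.
\<close>

definition disjoint_union ::
  "('a, 'b) network \<Rightarrow> ('a, 'c) network \<Rightarrow> ('a, 'b + 'c) network" where
  "disjoint_union N1 N2 =
     \<lparr> digr = \<lparr> verts = cells N1 \<union> cells N2, arcs = edges N1 <+> edges N2,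
                tail = case_sum (tail_cell N1) (tail_cell N2),
                head = case_sum (head_cell N1) (head_cell N2) \<rparr>,
       cell_type = (cells N1 \<union> cells N2) \<times> (cells N1 \<union> cells N2),
       edge_type = (edges N1 <+> edges N2) \<times> (edges N1 <+> edges N2) \<rparr>"


section \<open>Admissible vector fields\<close>

text \<open>
  Smoothness of a function of finitely many variables \<open>z i \<in> V\<close>, \<open>i \<in> I\<close>, i.e. of a function
  on the product of \<open>I\<close> copies of the Euclidean space \<open>V\<close>: partial derivatives of every order
  exist everywhere and are continuous. Such a function is represented as one on the full
  function space which depends on the variables in \<open>I\<close> only.
\<close>

coinductive smooth_in :: "'i set \<Rightarrow> (('i \<Rightarrow> 'v::euclidean_space) \<Rightarrow> 'w::real_normed_vector) \<Rightarrow> bool"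
  for I :: "'i set" where
  "\<lbrakk> \<And>x y. (\<forall>i\<in>I. x i = y i) \<Longrightarrow> f x = f y;
     continuous_on UNIV f;
     \<And>i b. i \<in> I \<Longrightarrow> b \<in> Basis \<Longrightarrow>
        \<exists>g. (\<forall>x. ((\<lambda>t. f (x(i := x i + t *\<^sub>R b))) has_vector_derivative g x) (at 0)) \<and>
            smooth_in I g \<rbrakk>
   \<Longrightarrow> smooth_in I f"

text \<open>Total phase space: one copy of the phase space \<open>'v\<close> for each cell.\<close>

definition phase_space :: "'a set \<Rightarrow> ('a \<Rightarrow> 'v) set" where
  "phase_space C = C \<rightarrow>\<^sub>E UNIV"

text \<open>
  The variables of the component \<open>f c\<close> of an admissible vector field are indexed by
  \<open>None\<close> (the internal variable \<open>x\<^sub>c\<close>) and \<open>Some e\<close> for each input edge \<open>e\<close> of \<open>c\<close> (the coupling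
  variable, at which the state of the tail cell of \<open>e\<close> is inserted).
\<close>

definition input_vars :: "('a, 'b) network \<Rightarrow> 'a \<Rightarrow> 'b option set" where
  "input_vars N c = insert None (Some ` input_edges N c)"

definition input_state :: "('a, 'b) network \<Rightarrow> 'a \<Rightarrow> ('a \<Rightarrow> 'v) \<Rightarrow> 'b option \<Rightarrow> 'v" where
  "input_state N c x = case_option (x c) (\<lambda>e. x (tail_cell N e))"

definition input_isomorphism ::
  "('a, 'b) network \<Rightarrow> 'a \<Rightarrow> 'a \<Rightarrow> ('b \<Rightarrow> 'b) \<Rightarrow> bool" where
  "input_isomorphism N c d \<beta> \<longleftrightarrow>
     (c, d) \<in> cell_type N \<and> bij_betw \<beta> (input_edges N c) (input_edges N d) \<and>
     (\<forall>e \<in> input_edges N c. (e, \<beta> e) \<in> edge_type N)"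

text \<open>
  The condition on \<open>\<beta>\<close> below says, for \<open>c = d\<close>, that \<open>f c\<close> is symmetric in the variables of
  edges of the same type, and, for \<open>c \<noteq> d\<close>, that cells of the same type with the same input
  (for a single edge-type: with the same valency) share the same function.
\<close>

definition admissible ::
  "('a, 'b) network \<Rightarrow> (('a \<Rightarrow> 'v::euclidean_space) \<Rightarrow> 'a \<Rightarrow> 'v) \<Rightarrow> bool" where
  "admissible N F \<longleftrightarrow>
     (\<exists>f :: 'a \<Rightarrow> ('b option \<Rightarrow> 'v) \<Rightarrow> 'v.
        (\<forall>c \<in> cells N. smooth_in (input_vars N c) (f c)) \<and>
        (\<forall>c \<in> cells N. \<forall>d \<in> cells N. \<forall>\<beta>. input_isomorphism N c d \<beta> \<longrightarrow>
            (\<forall>z. f d z = f c (z \<circ> map_option \<beta>))) \<and>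
        (\<forall>x \<in> phase_space (cells N). \<forall>c \<in> cells N. F x c = f c (input_state N c x)))"

definition solution_on ::
  "'a set \<Rightarrow> (('a \<Rightarrow> 'v::euclidean_space) \<Rightarrow> 'a \<Rightarrow> 'v) \<Rightarrow> real set \<Rightarrow> (real \<Rightarrow> 'a \<Rightarrow> 'v) \<Rightarrow> bool" where
  "solution_on C F J x \<longleftrightarrow>
     (\<forall>t \<in> J. x t \<in> phase_space C) \<and>
     (\<forall>t \<in> J. \<forall>c \<in> C. ((\<lambda>s. x s c) has_vector_derivative F (x t) c) (at t within J))"

definition flow_invariant ::
  "'a set \<Rightarrow> (('a \<Rightarrow> 'v::euclidean_space) \<Rightarrow> 'a \<Rightarrow> 'v) \<Rightarrow> ('a \<Rightarrow> 'v) set \<Rightarrow> bool" where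
  "flow_invariant C F \<Delta> \<longleftrightarrow>
     (\<forall>J x. is_interval J \<and> 0 \<in> J \<and> solution_on C F J x \<and> x 0 \<in> \<Delta> \<longrightarrow> (\<forall>t \<in> J. x t \<in> \<Delta>))"


section \<open>Synchrony subspaces\<close>

text \<open>
  \<open>R\<close> need not be an equivalence relation here: it may be any set of equality conditions.
\<close>

definition polydiagonal :: "'a set \<Rightarrow> 'a rel \<Rightarrow> ('a \<Rightarrow> 'v) set" where
  "polydiagonal C R = {x \<in> phase_space C. \<forall>(c, d) \<in> R. x c = x d}"

definition synchrony_subspaces :: "('a, 'b) network \<Rightarrow> ('a \<Rightarrow> 'v::euclidean_space) set set" where
  "synchrony_subspaces N =
     {\<Delta>. (\<exists>R. equiv (cells N) R \<and> \<Delta> = polydiagonal (cells N) R) \<and>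
         (\<forall>F. admissible N F \<longrightarrow> flow_invariant (cells N) F \<Delta>)}"

definition bipartite :: "'a set \<Rightarrow> 'a set \<Rightarrow> 'a rel \<Rightarrow> bool" where
  "bipartite C1 C2 R \<longleftrightarrow> (\<exists>K \<in> (C1 \<union> C2) // R. K \<inter> C1 \<noteq> {} \<and> K \<inter> C2 \<noteq> {})"

definition pairing :: "'a set \<Rightarrow> 'a set \<Rightarrow> 'a rel \<Rightarrow> bool" where
  "pairing C1 C2 R \<longleftrightarrow>
     (\<forall>K \<in> (C1 \<union> C2) // R. (\<exists>c. K = {c}) \<or> (\<exists>c \<in> C1. \<exists>d \<in> C2. K = {c, d}))"

text \<open>
  In the next three definitions the cell set of \<open>N\<close> is the disjoint union of \<open>C1\<close> and \<open>C2\<close>.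
  The relation \<open>R\<close> is determined by \<open>\<Delta>\<close> (as the phase space of a cell has positive dimension).
\<close>

definition nonbipartite_synchrony ::
  "('a, 'b) network \<Rightarrow> 'a set \<Rightarrow> 'a set \<Rightarrow> ('a \<Rightarrow> 'v::euclidean_space) set set" where
  "nonbipartite_synchrony N C1 C2 =
     {\<Delta> \<in> synchrony_subspaces N.
        \<exists>R. equiv (cells N) R \<and> \<Delta> = polydiagonal (cells N) R \<and> \<not> bipartite C1 C2 R}"

definition pairing_synchrony ::
  "('a, 'b) network \<Rightarrow> 'a set \<Rightarrow> 'a set \<Rightarrow> ('a \<Rightarrow> 'v::euclidean_space) set set" where
  "pairing_synchrony N C1 C2 =
     {\<Delta> \<in> synchrony_subspaces N.
        \<exists>R. equiv (cells N) R \<and> \<Delta> = polydiagonal (cells N) R \<and>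
            bipartite C1 C2 R \<and> pairing C1 C2 R}"

definition nonpairing_synchrony ::
  "('a, 'b) network \<Rightarrow> 'a set \<Rightarrow> 'a set \<Rightarrow> ('a \<Rightarrow> 'v::euclidean_space) set set" where
  "nonpairing_synchrony N C1 C2 =
     {\<Delta> \<in> synchrony_subspaces N.
        \<exists>R. equiv (cells N) R \<and> \<Delta> = polydiagonal (cells N) R \<and>
            bipartite C1 C2 R \<and> \<not> pairing C1 C2 R}"

definition extended_inter :: "'a set \<Rightarrow> 'a set \<Rightarrow> 'a rel \<Rightarrow> 'a rel \<Rightarrow> ('a \<Rightarrow> 'v) set" where
  "extended_inter C1 C2 R1 R2 = polydiagonal (C1 \<union> C2) R1 \<inter> polydiagonal (C1 \<union> C2) R2"


section \<open>Interior symmetries, quotients and lifts\<close>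

definition interior_symmetry :: "('a, 'b) network \<Rightarrow> 'a set \<Rightarrow> ('a \<Rightarrow> 'a) \<Rightarrow> bool" where
  "interior_symmetry N S \<sigma> \<longleftrightarrow>
     S \<subseteq> cells N \<and> \<sigma> permutes cells N \<and> (\<forall>c \<in> cells N - S. \<sigma> c = c) \<and>
     (\<forall>c \<in> S. \<forall>d \<in> cells N. adjacency N c d = adjacency N (\<sigma> c) (\<sigma> d))"

text \<open>
  Meant for balanced \<open>R\<close>. The edges of the quotient into a class \<open>K\<close> are the input edges of a
  representative of \<open>K\<close>; since \<open>R\<close> is balanced, the number of those with tail in a given class
  does not depend on the representative.
\<close>

definition quotient_edges :: "('a, 'b) network \<Rightarrow> 'a rel \<Rightarrow> 'b set" where
  "quotient_edges N R = (\<Union>K \<in> cells N // R. input_edges N (SOME c. c \<in> K))"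

definition quotient_network :: "('a, 'b) network \<Rightarrow> 'a rel \<Rightarrow> ('a set, 'b) network" where
  "quotient_network N R =
     \<lparr> digr = \<lparr> verts = cells N // R, arcs = quotient_edges N R,
                tail = (\<lambda>e. R `` {tail_cell N e}), head = (\<lambda>e. R `` {head_cell N e}) \<rparr>,
       cell_type = (\<lambda>(c, d). (R `` {c}, R `` {d})) ` cell_type N,
       edge_type = edge_type N \<inter> (quotient_edges N R \<times> quotient_edges N R) \<rparr>"

definition lift :: "'a set \<Rightarrow> 'a rel \<Rightarrow> 'a set rel \<Rightarrow> ('a \<Rightarrow> 'v) set" where
  "lift C R RQ =
     polydiagonal C (R \<union> {(c, d). c \<in> C \<and> d \<in> C \<and> (R `` {c}, R `` {d}) \<in> RQ})"

end

theory Submission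
  imports Defs
begin

text \<open>
  Everything rests on the equivalence of the dynamical and the combinatorial description of
  synchrony (\<open>polydiagonal_mem_synchrony_iff\<close>): in a network with one cell-type and one
  edge-type, the polydiagonal subspace of \<open>R\<close> is flow-invariant for all admissible vector
  fields if and only if \<open>R\<close> is balanced, i.e. \<open>R\<close>-related cells receive equally many edges
  from every \<open>R\<close>-class. If \<open>R\<close> is balanced, an admissible field is tangent to the subspace;
  smooth fields are locally Lipschitz, so by Gronwall's inequality the deviation of a
  trajectory from its projection to the subspace remains zero once it is zero. Conversely, one
  field suffices to enforce balance: the linear field whose component at \<open>c\<close> is the sum of the
  states at the tails of the input edges of \<open>c\<close>, started at the indicator function of a class.
  The initial velocity of that trajectory counts the input edges from the class.

  A polydiagonal subspace determines its equivalence relation because the phase space of a cell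
  is not zero. The theorem thereby turns into statements about balanced relations on a disjoint
  union, where no edge joins the two parts.

  Adding up over all classes, related cells have equal valency, so a relation that joins the two
  parts forces \<open>v1 = v2\<close>. A relation that does not join them splits into one relation on each
  part, and balance is checked on each part separately. If the nontrivial classes are pairs
  \<open>{c\<^sub>i, d\<^sub>i}\<close> across the parts, then among the two edge counts that make up the count from such
  a class, one is zero, and the balance condition says that the exchange of the \<open>c\<^sub>i\<close> and \<open>d\<^sub>i\<close>
  preserves the rows of the adjacency matrix that belong to these cells
  (\<open>balanced_iff_interior_symmetry\<close>).

  For a balanced relation \<open>R\<close> that joins the parts, keep only the pairs of \<open>R\<close> that lie on one
  side. This finer relation \<open>R'\<close> is still balanced, as a cell does not see the other part, and
  modulo \<open>R'\<close> every class of \<open>R\<close> has at most one point on each side. So \<open>R\<close> is the lift of a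
  pairing relation on the quotient by \<open>R'\<close>, and \<open>R'\<close> is nontrivial exactly if \<open>R\<close> itself is
  not pairing (\<open>nonpairing_iff_lift_of_pairing\<close>). Balance passes between a relation on the
  quotient and its lift because both count the same edges (\<open>balanced_lifted_rel_iff\<close>).
\<close>

section \<open>Smooth functions and Gronwall's inequality\<close>

lemma smooth_in_const: "smooth_in I (\<lambda>_. w)"
proof (coinduction arbitrary: w)
  case smooth_in
  then show ?case
    by (auto intro!: exI[of _ "\<lambda>_. 0"])
qed

lemma smooth_in_sum:
  fixes A :: "'i set"
  assumes "finite A" and "A \<subseteq> I"
  shows "smooth_in I (\<lambda>z. \<Sum>j\<in>A. z j :: 'v::euclidean_space)"
proof (rule smooth_in.intros)
  show "(\<Sum>j\<in>A. x j) = (\<Sum>j\<in>A. y j)" if "\<forall>i\<in>I. x i = y i" for x y :: "'i \<Rightarrow> 'v"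
    using that assms(2) by (intro sum.cong) auto
  show "continuous_on UNIV (\<lambda>z. \<Sum>j\<in>A. z j :: 'v)"
    by (intro continuous_on_sum continuous_on_product_coordinates)
  fix i and b :: 'v
  let ?w = "if i \<in> A then b else 0"
  have "((\<lambda>t. \<Sum>j\<in>A. (x(i := x i + t *\<^sub>R b)) j) has_vector_derivative ?w) (at 0)"
    for x :: "'i \<Rightarrow> 'v"
  proof -
    have "((\<lambda>t. \<Sum>j\<in>A. x j + (if j = i then t *\<^sub>R b else 0)) has_vector_derivative
          (\<Sum>j\<in>A. if j = i then b else 0)) (at 0)"
    proof (rule has_vector_derivative_sum)
      show "((\<lambda>t. x j + (if j = i then t *\<^sub>R b else 0)) has_vector_derivative
          (if j = i then b else 0)) (at 0)" for j
        by (cases "j = i") (auto intro!: derivative_eq_intros simp: has_vector_derivative_def)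
    qed
    moreover have "(\<Sum>j\<in>A. if j = i then b else 0) = ?w"
      using assms(1) by simp
    moreover have "(\<lambda>t. \<Sum>j\<in>A. (x(i := x i + t *\<^sub>R b)) j)
        = (\<lambda>t. \<Sum>j\<in>A. x j + (if j = i then t *\<^sub>R b else 0))"
      by (intro ext sum.cong) auto
    ultimately show ?thesis by simp
  qed
  then show "\<exists>g. (\<forall>x. ((\<lambda>t. \<Sum>j\<in>A. (x(i := x i + t *\<^sub>R b)) j) has_vector_derivative g x) (at 0))
      \<and> smooth_in I g"
    by (intro exI[of _ "\<lambda>_. ?w"] conjI allI smooth_in_const)
qed

lemma smooth_in_depends:
  assumes "smooth_in I f" and "\<And>i. i \<in> I \<Longrightarrow> x i = y i"
  shows "f x = f y"
  using assms by (auto elim: smooth_in.cases)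

text \<open>
  The index set may be infinite, but only the coordinates in \<open>I\<close> matter; setting all others to
  zero moves the argument into a compact product of boxes.
\<close>
lemma smooth_in_bounded_on_box:
  fixes f :: "('i \<Rightarrow> 'v::euclidean_space) \<Rightarrow> 'w::real_normed_vector"
  assumes "smooth_in I f"
  shows "\<exists>M. \<forall>z. (\<forall>i\<in>I. \<forall>b\<in>Basis. \<bar>z i \<bullet> b\<bar> \<le> B) \<longrightarrow> norm (f z) \<le> M"
proof -
  let ?S = "cbox (- (\<Sum>b\<in>Basis. B *\<^sub>R b)) (\<Sum>b\<in>Basis. B *\<^sub>R b) :: 'v set"
  let ?K = "Pi\<^sub>E UNIV (\<lambda>i. if i \<in> I then ?S else {0})"
  have "compactin (product_topology (\<lambda>_. euclidean) UNIV) ?K"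
    by (auto simp: compactin_PiE)
  then have "compact ?K"
    by (simp add: euclidean_product_topology)
  moreover have "continuous_on ?K f"
    using assms by (auto elim!: smooth_in.cases intro: continuous_on_subset)
  ultimately have "bounded (f ` ?K)"
    by (intro compact_imp_bounded compact_continuous_image)
  then obtain M where M: "\<And>z. z \<in> ?K \<Longrightarrow> norm (f z) \<le> M"
    by (auto simp: bounded_iff)
  have "norm (f z) \<le> M" if z: "\<forall>i\<in>I. \<forall>b\<in>Basis. \<bar>z i \<bullet> b\<bar> \<le> B" for z
  proof -
    have "f z = f (\<lambda>i. if i \<in> I then z i else 0)"
      by (rule smooth_in_depends[OF assms]) simp
    moreover have "(\<lambda>i. if i \<in> I then z i else 0) \<in> ?K"
      using z by (auto simp: mem_box abs_le_iff minus_le_iff)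
    ultimately show ?thesis using M by simp
  qed
  then show ?thesis by blast
qed

text \<open>
  A path from \<open>x\<close> to \<open>y\<close> that changes one real coordinate at a time stays in the box, and along
  each of its edges the mean value inequality applies with a bound of one partial derivative.
\<close>
lemma smooth_in_lipschitz_on_box:
  fixes f :: "('i \<Rightarrow> 'v::euclidean_space) \<Rightarrow> 'w::real_normed_vector"
  assumes f: "smooth_in I f" and I: "finite I"
  shows "\<exists>L\<ge>0. \<forall>x y. (\<forall>i\<in>I. \<forall>b\<in>Basis. \<bar>x i \<bullet> b\<bar> \<le> B \<and> \<bar>y i \<bullet> b\<bar> \<le> B) \<longrightarrow>
      norm (f x - f y) \<le> L * (\<Sum>i\<in>I. norm (x i - y i))"
proof -
  let ?box = "\<lambda>z::'i \<Rightarrow> 'v. \<forall>i\<in>I. \<forall>b\<in>Basis. \<bar>z i \<bullet> b\<bar> \<le> B"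
  have "\<exists>g M. (\<forall>x. ((\<lambda>t. f (x(i := x i + t *\<^sub>R b))) has_vector_derivative g x) (at 0)) \<and>
      (\<forall>z. ?box z \<longrightarrow> norm (g z) \<le> M)" if "i \<in> I" "b \<in> Basis" for i b
  proof -
    from f that obtain g where
      "\<forall>x. ((\<lambda>t. f (x(i := x i + t *\<^sub>R b))) has_vector_derivative g x) (at 0)" "smooth_in I g"
      by (elim smooth_in.cases) blast
    with smooth_in_bounded_on_box[of I g B] show ?thesis by blast
  qed
  then obtain g M where
    deriv: "\<And>i b x. i \<in> I \<Longrightarrow> b \<in> Basis \<Longrightarrow>
      ((\<lambda>t. f (x(i := x i + t *\<^sub>R b))) has_vector_derivative g i b x) (at 0)" and
    M: "\<And>i b z. i \<in> I \<Longrightarrow> b \<in> Basis \<Longrightarrow> ?box z \<Longrightarrow> norm (g i b z) \<le> M i b"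
    by metis
  let ?J = "I \<times> (Basis :: 'v set)"
  define L where "L = (\<Sum>(i, b)\<in>?J. \<bar>M i b\<bar>)"
  have J: "finite ?J" using I by simp
  have L0: "0 \<le> L" by (auto simp: L_def intro!: sum_nonneg)
  have M_le_L: "M i b \<le> L" if "i \<in> I" "b \<in> Basis" for i b
  proof -
    have "\<bar>M i b\<bar> \<le> L"
      unfolding L_def using member_le_sum[of "(i, b)" ?J "\<lambda>(i, b). \<bar>M i b\<bar>"] J that by auto
    then show ?thesis by linarith
  qed
  have main: "norm (f x - f y) \<le> L * real DIM('v) * (\<Sum>i\<in>I. norm (x i - y i))"
    if x: "?box x" and y: "?box y" for x y
  proof -
    \<comment> \<open>The point reached after the coordinates in \<open>S\<close> have been moved from \<open>x\<close> to \<open>y\<close>.\<close>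
    define mix where
      "mix S = (\<lambda>i. \<Sum>b\<in>Basis. (if (i, b) \<in> S then y i \<bullet> b else x i \<bullet> b) *\<^sub>R b)" for S
    have mix_inner: "mix S i \<bullet> b = (if (i, b) \<in> S then y i \<bullet> b else x i \<bullet> b)"
      if "b \<in> Basis" for S i b
      using that by (simp add: mix_def)
    have step: "norm (f (mix S) - f x) \<le> L * (\<Sum>(i, b)\<in>S. \<bar>(x i - y i) \<bullet> b\<bar>)"
      if "finite S" "S \<subseteq> ?J" for S
      using that
    proof (induction S rule: finite_induct)
      case empty
      have "mix {} = x" by (simp add: mix_def euclidean_representation)
      then show ?case by simp
    next
      case (insert p S)
      obtain i b where p: "p = (i, b)" by (cases p)
      with insert.prems have ib: "i \<in> I" "b \<in> Basis" by auto
      define d where "d = (y i - x i) \<bullet> b"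
      define h where "h t = (mix S)(i := mix S i + t *\<^sub>R b)" for t
      have mixS: "mix S i \<bullet> b = x i \<bullet> b"
        using insert.hyps ib by (simp add: mix_inner p)
      have h0: "h 0 = mix S" by (simp add: h_def)
      have hd: "h d = mix (insert p S)"
      proof (rule ext, rule euclidean_eqI)
        fix j and a :: 'v assume "a \<in> Basis"
        then show "h d j \<bullet> a = mix (insert p S) j \<bullet> a"
          using ib mixS
          by (auto simp: h_def mix_inner p d_def inner_Basis inner_add_left inner_diff_left)
      qed
      have h_box: "?box (h t)" if "t \<in> closed_segment 0 d" for t
      proof (intro ballI)
        fix j and a :: 'v assume ja: "j \<in> I" "a \<in> Basis"
        show "\<bar>h t j \<bullet> a\<bar> \<le> B"
        proof (cases "(j, a) = (i, b)")
          case True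
          have "\<bar>x i \<bullet> b\<bar> \<le> B" "\<bar>y i \<bullet> b\<bar> \<le> B" using x y ib by auto
          moreover have "h t j \<bullet> a = x i \<bullet> b + t"
            using True mixS ib by (simp add: h_def inner_add_left)
          moreover have "y i \<bullet> b = x i \<bullet> b + d" by (simp add: d_def inner_diff_left)
          ultimately show ?thesis
            using that by (auto simp: closed_segment_eq_real_ivl split: if_splits)
        next
          case False
          then have "h t j \<bullet> a = mix S j \<bullet> a"
            using ja ib by (auto simp: h_def inner_add_left inner_Basis)
          then show ?thesis using x y ja by (auto simp: mix_inner)
        qed
      qed
      have h_deriv: "((\<lambda>t. f (h t)) has_vector_derivative g i b (h t)) (at t within A)" for t A
      proof -
        have eq: "(h t)(i := h t i + s *\<^sub>R b) = h (s + t)" for s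
          by (auto simp: h_def fun_eq_iff scaleR_add_left)
        have "((\<lambda>s. f (h (s + t))) has_vector_derivative g i b (h t)) (at 0)"
          using deriv[OF ib, of "h t"] by (simp add: eq)
        then have "(((\<lambda>s. f (h (s + t))) \<circ> (\<lambda>s. s - t)) has_vector_derivative
            1 *\<^sub>R g i b (h t)) (at t)"
          by (intro vector_diff_chain_at) (auto intro!: derivative_eq_intros)
        then show ?thesis
          by (auto simp: o_def intro: has_vector_derivative_at_within)
      qed
      have "norm (f (h d) - f (h 0)) \<le> L * norm (d - 0)"
      proof (rule differentiable_bound[of "closed_segment 0 d"])
        fix t assume t: "t \<in> closed_segment 0 d"
        show "((\<lambda>t. f (h t)) has_derivative (\<lambda>s. s *\<^sub>R g i b (h t)))
            (at t within closed_segment 0 d)"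
          using h_deriv by (simp add: has_vector_derivative_def)
        show "onorm (\<lambda>s. s *\<^sub>R g i b (h t)) \<le> L"
        proof (rule onorm_le)
          fix s :: real
          have "norm (g i b (h t)) \<le> L" using M[OF ib h_box[OF t]] M_le_L[OF ib] by simp
          then show "norm (s *\<^sub>R g i b (h t)) \<le> L * norm s"
            by (simp add: mult.commute[of L] mult_left_mono)
        qed
      qed auto
      then have "norm (f (mix (insert p S)) - f (mix S)) \<le> L * \<bar>(x i - y i) \<bullet> b\<bar>"
        unfolding h0 hd by (simp add: d_def inner_diff_left abs_minus_commute)
      moreover have "norm (f (mix (insert p S)) - f x)
          \<le> norm (f (mix (insert p S)) - f (mix S)) + norm (f (mix S) - f x)"
        using norm_triangle_ineq[of "f (mix (insert p S)) - f (mix S)" "f (mix S) - f x"] by simp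
      moreover have "norm (f (mix S) - f x) \<le> L * (\<Sum>(i, b)\<in>S. \<bar>(x i - y i) \<bullet> b\<bar>)"
        using insert by auto
      ultimately show ?case
        using insert.hyps p by (simp add: distrib_left)
    qed
    have "f (mix ?J) = f y"
      by (rule smooth_in_depends[OF f]) (simp add: mix_def euclidean_representation)
    then have "norm (f x - f y) \<le> L * (\<Sum>(i, b)\<in>?J. \<bar>(x i - y i) \<bullet> b\<bar>)"
      using step[OF J] by (simp add: norm_minus_commute)
    also have "(\<Sum>(i, b)\<in>?J. \<bar>(x i - y i) \<bullet> b\<bar>)
        = (\<Sum>i\<in>I. \<Sum>b\<in>Basis. \<bar>(x i - y i) \<bullet> b\<bar>)"
      by (simp add: sum.cartesian_product)
    also have "\<dots> \<le> (\<Sum>i\<in>I. \<Sum>b\<in>(Basis::'v set). norm (x i - y i))"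
      by (intro sum_mono Basis_le_norm) auto
    also have "\<dots> = real DIM('v) * (\<Sum>i\<in>I. norm (x i - y i))"
      by (simp add: sum_distrib_left)
    finally show ?thesis using L0 by (simp add: mult_left_mono mult.assoc)
  qed
  show ?thesis
    by (rule exI[of _ "L * real DIM('v)"]) (use main L0 in auto)
qed

text \<open>
  The bound on the absolute value of the derivative makes the inequality usable in both time
  directions: for \<open>0 \<le> T\<close> the function \<open>\<phi> t * exp (- K * t)\<close> decreases, for \<open>T < 0\<close> the
  function \<open>\<phi> t * exp (K * t)\<close> increases.
\<close>
lemma gronwall_zero:
  fixes \<phi> :: "real \<Rightarrow> real"
  assumes deriv: "\<And>t. t \<in> closed_segment 0 T \<Longrightarrow>
      (\<phi> has_real_derivative \<phi>' t) (at t within closed_segment 0 T)"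
    and bound: "\<And>t. t \<in> closed_segment 0 T \<Longrightarrow> \<bar>\<phi>' t\<bar> \<le> K * \<phi> t"
    and zero: "\<phi> 0 = 0"
  shows "\<phi> T \<le> 0"
proof (cases "0 \<le> T")
  case True
  let ?\<psi> = "\<lambda>t. \<phi> t * exp (- K * t)"
  have "\<exists>t\<in>{0..T}. ?\<psi> T - ?\<psi> 0 = (\<phi>' t - K * \<phi> t) * exp (- K * t) * (T - 0)"
  proof (rule mvt_very_simple)
    fix t assume "0 \<le> t" "t \<le> T"
    then have "(\<phi> has_real_derivative \<phi>' t) (at t within {0..T})"
      using deriv[of t] True by (auto simp: closed_segment_eq_real_ivl)
    then have "(?\<psi> has_real_derivative (\<phi>' t - K * \<phi> t) * exp (- K * t)) (at t within {0..T})"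
      by (auto intro!: derivative_eq_intros simp: algebra_simps)
    then show "(?\<psi> has_derivative (\<lambda>h. (\<phi>' t - K * \<phi> t) * exp (- K * t) * h)) (at t within {0..T})"
      by (simp add: has_field_derivative_def)
  qed (use True in auto)
  then obtain t where t: "t \<in> {0..T}"
    "\<phi> T * exp (- K * T) = (\<phi>' t - K * \<phi> t) * (exp (- K * t) * T)"
    using zero by (auto simp: mult.assoc)
  have "\<phi>' t - K * \<phi> t \<le> 0"
    using bound[of t] t True by (auto simp: closed_segment_eq_real_ivl)
  then have "\<phi> T * exp (- K * T) \<le> 0"
    unfolding t(2) using True by (intro mult_nonpos_nonneg) auto
  then show ?thesis by (simp add: mult_le_0_iff)
next
  case False
  let ?\<psi> = "\<lambda>t. \<phi> t * exp (K * t)"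
  have "\<exists>t\<in>{T..0}. ?\<psi> 0 - ?\<psi> T = (\<phi>' t + K * \<phi> t) * exp (K * t) * (0 - T)"
  proof (rule mvt_very_simple)
    fix t assume "T \<le> t" "t \<le> 0"
    then have "(\<phi> has_real_derivative \<phi>' t) (at t within {T..0})"
      using deriv[of t] False by (auto simp: closed_segment_eq_real_ivl)
    then have "(?\<psi> has_real_derivative (\<phi>' t + K * \<phi> t) * exp (K * t)) (at t within {T..0})"
      by (auto intro!: derivative_eq_intros simp: algebra_simps)
    then show "(?\<psi> has_derivative (\<lambda>h. (\<phi>' t + K * \<phi> t) * exp (K * t) * h)) (at t within {T..0})"
      by (simp add: has_field_derivative_def)
  qed (use False in auto)
  then obtain t where t: "t \<in> {T..0}"
    "\<phi> T * exp (K * T) = (\<phi>' t + K * \<phi> t) * (exp (K * t) * T)"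
    using zero by (auto simp: mult.assoc)
  have "\<phi>' t + K * \<phi> t \<ge> 0"
    using bound[of t] t False by (auto simp: closed_segment_eq_real_ivl)
  then have "\<phi> T * exp (K * T) \<le> 0"
    unfolding t(2) using False by (intro mult_nonneg_nonpos mult_nonneg_nonpos) auto
  then show ?thesis by (simp add: mult_le_0_iff)
qed

section \<open>Balanced relations and flow-invariance\<close>

definition homogeneous :: "('a, 'b) network \<Rightarrow> bool" where
  "homogeneous N \<longleftrightarrow> fin_digraph (digr N) \<and> cell_type N = cells N \<times> cells N \<and>
     edge_type N = edges N \<times> edges N"

definition input_count :: "('a, 'b) network \<Rightarrow> 'a \<Rightarrow> 'a set \<Rightarrow> nat" where
  "input_count N c K = card {e \<in> input_edges N c. tail_cell N e \<in> K}"

text \<open>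
  For a single edge-type, a bijection of input edges that preserves the classes of the tails
  exists if and only if these counts agree.
\<close>
definition balanced :: "('a, 'b) network \<Rightarrow> 'a rel \<Rightarrow> bool" where
  "balanced N R \<longleftrightarrow>
     (\<forall>(c, d) \<in> R. \<forall>K \<in> cells N // R. input_count N c K = input_count N d K)"

lemma balancedD:
  "balanced N R \<Longrightarrow> (c, d) \<in> R \<Longrightarrow> K \<in> cells N // R \<Longrightarrow> input_count N c K = input_count N d K"
  by (auto simp: balanced_def)

lemma in_class_iff:
  assumes "equiv C R" and "K \<in> C // R" and "(a, b) \<in> R"
  shows "a \<in> K \<longleftrightarrow> b \<in> K"
  using in_quotient_imp_closed[OF assms(1,2)] assms(1,3) by (meson equiv_def symE)

lemma class_eqI:
  assumes "equiv C R" and "K \<in> C // R" and "a \<in> K"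
  shows "R `` {a} = K"
  using assms by (auto elim!: quotientE dest: equiv_class_eq[OF assms(1)])

lemma homogeneous_simps:
  assumes "homogeneous N"
  shows "finite (cells N)" and "finite (edges N)" and "finite (input_edges N c)"
    and "e \<in> edges N \<Longrightarrow> tail_cell N e \<in> cells N"
    and "e \<in> edges N \<Longrightarrow> head_cell N e \<in> cells N"
    and "e \<in> input_edges N c \<Longrightarrow> tail_cell N e \<in> cells N"
proof -
  interpret fin_digraph "digr N" using assms by (simp add: homogeneous_def)
  show "finite (cells N)" "finite (edges N)" by simp_all
  then show "finite (input_edges N c)"
    by (rule_tac finite_subset[of _ "edges N"]) (auto simp: in_arcs_def)
  show "e \<in> edges N \<Longrightarrow> tail_cell N e \<in> cells N" "e \<in> edges N \<Longrightarrow> head_cell N e \<in> cells N"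
    "e \<in> input_edges N c \<Longrightarrow> tail_cell N e \<in> cells N"
    by (simp_all add: in_arcs_def)
qed

text \<open>
  The bijections between the input edges from each class are glued together.
\<close>
lemma balanced_imp_class_preserving_isomorphism:
  assumes N: "homogeneous N" and R: "equiv (cells N) R" and bal: "balanced N R"
    and cd: "(c, d) \<in> R"
  shows "\<exists>\<beta>. input_isomorphism N c d \<beta> \<and>
    (\<forall>e \<in> input_edges N c. (tail_cell N e, tail_cell N (\<beta> e)) \<in> R)"
proof -
  let ?in = "\<lambda>c K. {e \<in> input_edges N c. tail_cell N e \<in> K}"
  have "\<exists>\<gamma>. bij_betw \<gamma> (?in c K) (?in d K)" if "K \<in> cells N // R" for K
  proof (rule finite_same_card_bij)
    show "finite (?in c K)" "finite (?in d K)"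
      using homogeneous_simps(3)[OF N] by (auto intro: rev_finite_subset simp del: in_in_arcs_conv)
    show "card (?in c K) = card (?in d K)"
      using balancedD[OF bal cd that] by (simp add: input_count_def)
  qed
  then have "\<forall>K\<in>cells N // R. \<exists>\<gamma>. bij_betw \<gamma> (?in c K) (?in d K)" by blast
  from bchoice[OF this] obtain \<gamma> where
    \<gamma>: "\<And>K. K \<in> cells N // R \<Longrightarrow> bij_betw (\<gamma> K) (?in c K) (?in d K)" by blast
  define \<beta> where "\<beta> e = \<gamma> (R `` {tail_cell N e}) e" for e
  have bij: "bij_betw \<beta> (?in c K) (?in d K)" if "K \<in> cells N // R" for K
  proof (rule iffD1[OF bij_betw_cong \<gamma>[OF that]])
    show "\<gamma> K e = \<beta> e" if "e \<in> ?in c K" for e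
      using class_eqI[OF R \<open>K \<in> cells N // R\<close>] that by (simp add: \<beta>_def)
  qed
  have cover: "(\<Union>K \<in> cells N // R. ?in a K) = input_edges N a" for a
  proof -
    have "tail_cell N e \<in> \<Union>(cells N // R)" if "e \<in> input_edges N a" for e
      using homogeneous_simps(6)[OF N that] Union_quotient[OF R] by simp
    then show ?thesis by blast
  qed
  have "disjoint_family_on (?in d) (cells N // R)"
    using quotient_disj[OF R] by (auto simp: disjoint_family_on_def)
  then have "bij_betw \<beta> (input_edges N c) (input_edges N d)"
    using bij_betw_UNION_disjoint[of "?in d" "cells N // R" \<beta> "?in c"] bij
    by (simp only: cover)
  moreover have "(tail_cell N e, tail_cell N (\<beta> e)) \<in> R" if e: "e \<in> input_edges N c" for e
  proof -
    let ?K = "R `` {tail_cell N e}"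
    have t: "tail_cell N e \<in> cells N" using homogeneous_simps(6)[OF N e] .
    then have "?K \<in> cells N // R" by (rule quotientI)
    moreover have "e \<in> ?in c ?K" using e t R by (auto simp: equiv_def refl_on_def)
    ultimately have "\<beta> e \<in> ?in d ?K" using bij by (meson bij_betwE)
    then show ?thesis by simp
  qed
  moreover have "(c, d) \<in> cell_type N"
    using N cd equiv_type[OF R] by (auto simp: homogeneous_def)
  ultimately have "input_isomorphism N c d \<beta> \<and>
      (\<forall>e \<in> input_edges N c. (tail_cell N e, tail_cell N (\<beta> e)) \<in> R)"
    using N bij_betwE[of \<beta> "input_edges N c" "input_edges N d"]
    by (auto simp: input_isomorphism_def homogeneous_def)
  then show ?thesis by blast
qed

text \<open>
  At a point of the subspace, a class-preserving input isomorphism carries the input state of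
  \<open>c\<close> to that of \<open>d\<close>, and the components at \<open>c\<close> and \<open>d\<close> of the field are the same function up to this relabelling.
\<close>
lemma admissible_tangent_to_balanced:
  assumes N: "homogeneous N" and R: "equiv (cells N) R" and bal: "balanced N R"
    and F: "admissible N F" and x: "x \<in> polydiagonal (cells N) R" and cd: "(c, d) \<in> R"
  shows "F x c = F x d"
proof -
  have cells: "c \<in> cells N" "d \<in> cells N" using cd equiv_type[OF R] by auto
  from F obtain f where
    smooth: "\<forall>c \<in> cells N. smooth_in (input_vars N c) (f c)" and
    sym: "\<forall>c \<in> cells N. \<forall>d \<in> cells N. \<forall>\<beta>. input_isomorphism N c d \<beta> \<longrightarrow>
            (\<forall>z. f d z = f c (z \<circ> map_option \<beta>))" and
    f: "\<forall>x \<in> phase_space (cells N). \<forall>c \<in> cells N. F x c = f c (input_state N c x)"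
    unfolding admissible_def by blast
  obtain \<beta> where \<beta>: "input_isomorphism N c d \<beta>"
    "\<forall>e \<in> input_edges N c. (tail_cell N e, tail_cell N (\<beta> e)) \<in> R"
    using balanced_imp_class_preserving_isomorphism[OF N R bal cd] by blast
  have x': "x \<in> phase_space (cells N)" using x by (simp add: polydiagonal_def)
  have eq: "x a = x b" if "(a, b) \<in> R" for a b
    using x that by (auto simp: polydiagonal_def)
  have "F x d = f c (input_state N d x \<circ> map_option \<beta>)"
    using f x' sym \<beta>(1) cells cd by simp
  also have "\<dots> = f c (input_state N c x)"
  proof (rule smooth_in_depends[of "input_vars N c" "f c"])
    show "smooth_in (input_vars N c) (f c)" using smooth cells(1) by blast
    fix i assume "i \<in> input_vars N c"
    then show "(input_state N d x \<circ> map_option \<beta>) i = input_state N c x i"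
      unfolding input_vars_def input_state_def using \<beta>(2) cd
      by (elim insertE imageE) (auto simp del: in_in_arcs_conv intro: eq[symmetric])
  qed
  finally show ?thesis using f x' cells cd by simp
qed

lemma inner_self_has_real_derivative:
  fixes u :: "real \<Rightarrow> 'v::real_inner"
  assumes "(u has_vector_derivative u') (at t within S)"
  shows "((\<lambda>t. u t \<bullet> u t) has_real_derivative 2 * (u t \<bullet> u')) (at t within S)"
  using assms unfolding has_vector_derivative_def has_field_derivative_def
  by (auto intro!: derivative_eq_intros simp: inner_commute algebra_simps)

text \<open>
  Along a trajectory \<open>x\<close>, let \<open>y\<close> take at each cell the state of \<open>x\<close> at a representative \<open>r c\<close>
  of its class. As \<open>y\<close> lies in the subspace, the field at \<open>y\<close> has equal components at \<open>c\<close> and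
  \<open>r c\<close>; hence the derivative of \<open>u c = x c - x (r c)\<close> is bounded by a multiple of \<open>x - y\<close>,
  that is, of \<open>u\<close> itself. Gronwall's inequality for the sum of the \<open>\<bar>u c\<bar>\<^sup>2\<close> gives \<open>u = 0\<close>.
\<close>
lemma balanced_imp_flow_invariant:
  fixes F :: "('a \<Rightarrow> 'v::euclidean_space) \<Rightarrow> 'a \<Rightarrow> 'v"
  assumes N: "homogeneous N" and R: "equiv (cells N) R" and bal: "balanced N R"
    and F: "admissible N F"
  shows "flow_invariant (cells N) F (polydiagonal (cells N) R)"
  unfolding flow_invariant_def
proof (intro allI impI ballI, elim conjE)
  fix J :: "real set" and x T
  assume J: "is_interval J" "0 \<in> J" and sol: "solution_on (cells N) F J x"
    and x0: "x 0 \<in> polydiagonal (cells N) R" and T: "T \<in> J"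
  let ?C = "cells N" and ?I = "closed_segment 0 T"
  note fin = homogeneous_simps[OF N]
  have I: "?I \<subseteq> J"
    using J T by (simp add: closed_segment_subset is_interval_convex)
  have x: "x t \<in> phase_space ?C"
    and x': "c \<in> ?C \<Longrightarrow> ((\<lambda>s. x s c) has_vector_derivative F (x t) c) (at t within ?I)"
    if "t \<in> ?I" for t c
    using sol that I unfolding solution_on_def
    by (blast intro: has_vector_derivative_within_subset)+

  define r where "r c = (SOME d. d \<in> R `` {c})" for c
  have r: "(c, r c) \<in> R" "r c \<in> ?C" if "c \<in> ?C" for c
  proof -
    have "c \<in> R `` {c}" using R that by (auto simp: equiv_def refl_on_def)
    then have "r c \<in> R `` {c}" unfolding r_def by (rule someI)
    then show "(c, r c) \<in> R" "r c \<in> ?C" using equiv_type[OF R] by auto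
  qed
  have r_eq: "r c = r d" if "(c, d) \<in> R" for c d
    unfolding r_def using equiv_class_eq[OF R that] by simp
  define y where "y t = (\<lambda>c. if c \<in> ?C then x t (r c) else undefined)" for t
  have y: "y t \<in> polydiagonal ?C R" for t
    using r_eq equiv_type[OF R] by (auto simp: polydiagonal_def phase_space_def y_def)
  have y_phase: "y t \<in> phase_space ?C" for t using y by (simp add: polydiagonal_def)

  have "\<exists>B. \<forall>t\<in>?I. norm (x t c) \<le> B" if "c \<in> ?C" for c
  proof -
    have "continuous_on ?I (\<lambda>t. x t c)"
      using x' that by (meson continuous_on_vector_derivative)
    then have "bounded ((\<lambda>t. x t c) ` ?I)"
      by (intro compact_imp_bounded compact_continuous_image) auto
    then show ?thesis by (auto simp: bounded_iff)
  qed
  then obtain B where B: "\<And>c t. c \<in> ?C \<Longrightarrow> t \<in> ?I \<Longrightarrow> norm (x t c) \<le> B c" by metis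
  define b where "b = (\<Sum>c\<in>?C. \<bar>B c\<bar>)"
  have box: "\<bar>x t c \<bullet> a\<bar> \<le> b" if "c \<in> ?C" "t \<in> ?I" "a \<in> Basis" for c t a
  proof -
    have "\<bar>x t c \<bullet> a\<bar> \<le> norm (x t c)" using that by (simp add: Basis_le_norm)
    also have "\<dots> \<le> \<bar>B c\<bar>" using B[OF that(1,2)] by simp
    also have "\<dots> \<le> b" unfolding b_def using that(1) fin(1) by (intro member_le_sum) auto
    finally show ?thesis .
  qed

  from F obtain f where
    smooth: "\<forall>c \<in> ?C. smooth_in (input_vars N c) (f c)" and
    f: "\<forall>x \<in> phase_space ?C. \<forall>c \<in> ?C. F x c = f c (input_state N c x)"
    unfolding admissible_def by blast
  have vars: "finite (input_vars N c)" for c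
    using fin(3) by (simp add: input_vars_def)
  define lip where "lip c L \<longleftrightarrow> 0 \<le> L \<and> (\<forall>z w.
      (\<forall>i\<in>input_vars N c. \<forall>a\<in>Basis. \<bar>z i \<bullet> a\<bar> \<le> b \<and> \<bar>w i \<bullet> a\<bar> \<le> b) \<longrightarrow>
      norm (f c z - f c w) \<le> L * (\<Sum>i\<in>input_vars N c. norm (z i - w i)))" for c L
  have "\<exists>L. lip c L" if "c \<in> ?C" for c
    using smooth_in_lipschitz_on_box[of "input_vars N c" "f c" b] smooth that vars
    unfolding lip_def by blast
  then obtain L where lip: "\<And>c. c \<in> ?C \<Longrightarrow> lip c (L c)" by metis
  have L0: "0 \<le> L c" if "c \<in> ?C" for c
    using lip[OF that] by (simp add: lip_def)
  have L: "norm (f c z - f c w) \<le> L c * (\<Sum>i\<in>input_vars N c. norm (z i - w i))"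
    if "c \<in> ?C" "\<forall>i\<in>input_vars N c. \<forall>a\<in>Basis. \<bar>z i \<bullet> a\<bar> \<le> b \<and> \<bar>w i \<bullet> a\<bar> \<le> b" for c z w
    using lip[OF that(1)] that(2) unfolding lip_def by blast

  define u where "u t c = x t c - x t (r c)" for t c
  define S where "S t = (\<Sum>c\<in>?C. norm (u t c))" for t
  define M where "M = (\<Sum>c\<in>?C. L c * real (card (input_vars N c)))"
  have S0: "0 \<le> S t" for t by (simp add: S_def sum_nonneg)
  have M0: "0 \<le> M" by (auto simp: M_def intro!: sum_nonneg mult_nonneg_nonneg L0)
  have diff: "norm (F (x t) c - F (y t) c) \<le> M * S t" if c: "c \<in> ?C" and t: "t \<in> ?I" for c t
  proof -
    have state: "\<exists>d\<in>?C. input_state N c (x t) i = x t d \<and> input_state N c (y t) i = x t (r d)"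
      if "i \<in> input_vars N c" for i
      using that c fin(6) by (force simp: input_vars_def input_state_def y_def)
    have "norm (F (x t) c - F (y t) c)
        = norm (f c (input_state N c (x t)) - f c (input_state N c (y t)))"
      using f x[OF t] y_phase c by simp
    also have "\<dots> \<le> L c * (\<Sum>i\<in>input_vars N c.
        norm (input_state N c (x t) i - input_state N c (y t) i))"
      by (rule L[OF c]) (metis state box r(2) t)
    also have "\<dots> \<le> L c * (\<Sum>i\<in>input_vars N c. S t)"
    proof (intro mult_left_mono sum_mono L0 c)
      fix i assume "i \<in> input_vars N c"
      then obtain d where d: "d \<in> ?C"
        "input_state N c (x t) i = x t d" "input_state N c (y t) i = x t (r d)"
        using state by blast
      have "norm (u t d) \<le> S t"
        unfolding S_def using d(1) fin(1) by (intro member_le_sum) auto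
      then show "norm (input_state N c (x t) i - input_state N c (y t) i) \<le> S t"
        by (simp add: d u_def)
    qed
    also have "\<dots> = (L c * real (card (input_vars N c))) * S t" by simp
    also have "\<dots> \<le> M * S t"
      unfolding M_def using c fin(1) L0
      by (intro mult_right_mono S0 member_le_sum) auto
    finally show ?thesis .
  qed
  have u'_bound: "norm (F (x t) c - F (x t) (r c)) \<le> 2 * M * S t" if c: "c \<in> ?C" and t: "t \<in> ?I"
    for c t
  proof -
    have "F (y t) c = F (y t) (r c)"
      by (rule admissible_tangent_to_balanced[OF N R bal F y r(1)[OF c]])
    then have "F (x t) c - F (x t) (r c)
        = (F (x t) c - F (y t) c) - (F (x t) (r c) - F (y t) (r c))" by simp
    also have "norm \<dots> \<le> norm (F (x t) c - F (y t) c) + norm (F (x t) (r c) - F (y t) (r c))"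
      by (rule norm_triangle_ineq4)
    also have "\<dots> \<le> M * S t + M * S t"
      by (intro add_mono diff c t r)
    finally show ?thesis by simp
  qed

  define \<phi> where "\<phi> t = (\<Sum>c\<in>?C. u t c \<bullet> u t c)" for t
  define \<phi>' where "\<phi>' t = (\<Sum>c\<in>?C. 2 * (u t c \<bullet> (F (x t) c - F (x t) (r c))))" for t
  have "\<phi> T \<le> 0"
  proof (rule gronwall_zero[where \<phi> = \<phi> and \<phi>' = \<phi>' and K = "4 * M * real (card ?C)"])
    fix t assume t: "t \<in> ?I"
    have "((\<lambda>t. u t c) has_vector_derivative F (x t) c - F (x t) (r c)) (at t within ?I)"
      if "c \<in> ?C" for c
      unfolding u_def using that t r(2) by (intro has_vector_derivative_diff x') auto
    then show "(\<phi> has_real_derivative \<phi>' t) (at t within ?I)"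
      unfolding \<phi>_def \<phi>'_def by (intro DERIV_sum inner_self_has_real_derivative)
    have "\<bar>\<phi>' t\<bar> \<le> (\<Sum>c\<in>?C. \<bar>2 * (u t c \<bullet> (F (x t) c - F (x t) (r c)))\<bar>)"
      unfolding \<phi>'_def by (rule sum_abs)
    also have "\<dots> \<le> (\<Sum>c\<in>?C. norm (u t c) * (4 * M * S t))"
    proof (rule sum_mono)
      fix c assume c: "c \<in> ?C"
      have "\<bar>u t c \<bullet> (F (x t) c - F (x t) (r c))\<bar>
          \<le> norm (u t c) * norm (F (x t) c - F (x t) (r c))"
        by (rule Cauchy_Schwarz_ineq2)
      also have "\<dots> \<le> norm (u t c) * (2 * M * S t)"
        by (intro mult_left_mono u'_bound c t) simp
      finally show "\<bar>2 * (u t c \<bullet> (F (x t) c - F (x t) (r c)))\<bar> \<le> norm (u t c) * (4 * M * S t)"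
        by (simp add: abs_mult algebra_simps)
    qed
    also have "\<dots> = 4 * M * (S t)\<^sup>2"
      by (simp add: sum_distrib_right[symmetric] S_def power2_eq_square)
    also have "\<dots> \<le> 4 * M * (real (card ?C) * \<phi> t)"
    proof (rule mult_left_mono)
      have "(S t)\<^sup>2 \<le> (\<Sum>c\<in>?C. (norm (u t c))\<^sup>2) * real (card ?C)"
        unfolding S_def by (rule sum_squared_le_sum_of_squares)
      then show "(S t)\<^sup>2 \<le> real (card ?C) * \<phi> t"
        by (simp add: \<phi>_def power2_norm_eq_inner mult.commute)
    qed (use M0 in simp)
    finally show "\<bar>\<phi>' t\<bar> \<le> 4 * M * real (card ?C) * \<phi> t" by (simp add: mult.assoc)
  next
    have "u 0 c = 0" if "c \<in> ?C" for c
      using x0 r(1)[OF that] by (auto simp: u_def polydiagonal_def)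
    then show "\<phi> 0 = 0" by (simp add: \<phi>_def)
  qed
  moreover have "0 \<le> \<phi> T" by (simp add: \<phi>_def sum_nonneg)
  ultimately have "\<phi> T = 0" by simp
  then have "u T c = 0" if "c \<in> ?C" for c
    using that fin(1) by (simp add: \<phi>_def sum_nonneg_eq_0_iff)
  then have "x T c = x T (r c)" if "c \<in> ?C" for c
    using that by (simp add: u_def)
  then have "x T c = x T d" if "(c, d) \<in> R" for c d
    using that r_eq equiv_type[OF R] by (metis SigmaD1 SigmaD2 subsetD)
  then show "x T \<in> polydiagonal ?C R"
    using x[of T] by (auto simp: polydiagonal_def)
qed

text \<open>The number of walks of length \<open>n\<close> that start in \<open>K\<close> and end at \<open>c\<close>.\<close>
primrec walk_count :: "('a, 'b) network \<Rightarrow> 'a set \<Rightarrow> nat \<Rightarrow> 'a \<Rightarrow> real" where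
  "walk_count N K 0 c = indicator K c"
| "walk_count N K (Suc n) c = (\<Sum>e\<in>input_edges N c. walk_count N K n (tail_cell N e))"

lemma walk_count_bounds:
  assumes "homogeneous N"
  shows "0 \<le> walk_count N K n c \<and> walk_count N K n c \<le> real (card (edges N)) ^ n"
proof (induction n arbitrary: c)
  case (Suc n)
  let ?V = "real (card (edges N))"
  have "card (input_edges N c) \<le> card (edges N)"
    using homogeneous_simps(2)[OF assms] by (intro card_mono) (auto simp: in_arcs_def)
  have "walk_count N K (Suc n) c \<le> (\<Sum>e\<in>input_edges N c. ?V ^ n)"
    unfolding walk_count.simps using Suc by (intro sum_mono) blast
  also have "\<dots> \<le> ?V * ?V ^ n"
    using \<open>card (input_edges N c) \<le> card (edges N)\<close> by (simp add: mult_right_mono)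
  finally have "walk_count N K (Suc n) c \<le> ?V * ?V ^ n" .
  then show ?case using Suc by (auto intro: sum_nonneg)
qed (auto simp: indicator_def)

text \<open>
  The component at \<open>c\<close> of \<open>exp (t A)\<close> applied to the indicator function of \<open>K\<close>, where \<open>A\<close> is
  the adjacency matrix: the solution of the linear system \<open>x' = A x\<close> that starts there.
\<close>
definition walk_series :: "('a, 'b) network \<Rightarrow> 'a set \<Rightarrow> 'a \<Rightarrow> real \<Rightarrow> real" where
  "walk_series N K c t = (\<Sum>n. walk_count N K n c / fact n * t ^ n)"

lemma walk_series_summable:
  assumes "homogeneous N"
  shows "summable (\<lambda>n. walk_count N K n c / fact n * t ^ n)"
proof (rule summable_comparison_test')
  let ?V = "real (card (edges N))"
  show "summable (\<lambda>n. inverse (fact n) * (?V * \<bar>t\<bar>) ^ n)" by (rule summable_exp)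
  show "norm (walk_count N K n c / fact n * t ^ n) \<le> inverse (fact n) * (?V * \<bar>t\<bar>) ^ n"
    if "0 \<le> n" for n
    using walk_count_bounds[OF assms, of K n c]
    by (auto simp: abs_mult power_abs divide_simps power_mult_distrib mult_right_mono)
qed

lemma walk_series_has_derivative:
  assumes N: "homogeneous N"
  shows "(walk_series N K c has_real_derivative
      (\<Sum>e\<in>input_edges N c. walk_series N K (tail_cell N e) t)) (at t)"
proof -
  let ?a = "\<lambda>c n. walk_count N K n c / fact n"
  have "diffs (?a c) n = (\<Sum>e\<in>input_edges N c. ?a (tail_cell N e) n)" for n
    by (simp add: diffs_def sum_divide_distrib[symmetric] del: of_nat_Suc)
  then have "(\<Sum>n. diffs (?a c) n * t ^ n)
      = (\<Sum>n. \<Sum>e\<in>input_edges N c. ?a (tail_cell N e) n * t ^ n)"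
    by (simp add: sum_distrib_right)
  also have "\<dots> = (\<Sum>e\<in>input_edges N c. walk_series N K (tail_cell N e) t)"
    unfolding walk_series_def by (rule suminf_sum) (rule walk_series_summable[OF N])
  finally show ?thesis
    using termdiffs_strong_converges_everywhere[of "?a c" t] walk_series_summable[OF N]
    by (simp add: walk_series_def[abs_def])
qed

lemma input_sum_admissible:
  assumes N: "homogeneous N"
  shows "admissible N (\<lambda>x c. \<Sum>e\<in>input_edges N c. x (tail_cell N e) :: 'v::euclidean_space)"
  unfolding admissible_def
proof (intro exI conjI ballI allI impI)
  fix c assume "c \<in> cells N"
  show "smooth_in (input_vars N c) (\<lambda>z. \<Sum>i\<in>Some ` input_edges N c. z i :: 'v)"
    using homogeneous_simps(3)[OF N] by (intro smooth_in_sum) (auto simp: input_vars_def)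
next
  fix c d \<beta> and z :: "'b option \<Rightarrow> 'v"
  assume "input_isomorphism N c d \<beta>"
  then have "bij_betw \<beta> (input_edges N c) (input_edges N d)"
    by (simp add: input_isomorphism_def)
  then show "(\<Sum>i\<in>Some ` input_edges N d. z i)
      = (\<Sum>i\<in>Some ` input_edges N c. (z \<circ> map_option \<beta>) i)"
    by (simp add: sum.reindex sum.reindex_bij_betw[symmetric, where h = \<beta>])
qed (simp add: sum.reindex input_state_def)

text \<open>
  The trajectory of the linear field that starts at the indicator function of a class \<open>K\<close> (times
  a nonzero vector) starts in the subspace, so it has equal components at related cells \<open>c\<close> and
  \<open>d\<close>. Their derivatives at time zero count the edges from \<open>K\<close> to \<open>c\<close> and to \<open>d\<close>.
\<close>
lemma flow_invariant_imp_balanced: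
  assumes N: "homogeneous N" and R: "equiv (cells N) R"
    and inv: "\<And>F. admissible N F \<Longrightarrow>
      flow_invariant (cells N) F (polydiagonal (cells N) R :: ('a \<Rightarrow> 'v::euclidean_space) set)"
  shows "balanced N R"
  unfolding balanced_def
proof safe
  fix c d K assume cd: "(c, d) \<in> R" and K: "K \<in> cells N // R"
  let ?C = "cells N"
  have cells: "c \<in> ?C" "d \<in> ?C" using cd equiv_type[OF R] by auto
  obtain b :: 'v where b: "b \<in> Basis" using nonempty_Basis by blast
  define F where "F x c = (\<Sum>e\<in>input_edges N c. x (tail_cell N e))" for x :: "'a \<Rightarrow> 'v" and c
  define x where "x t = (\<lambda>c. if c \<in> ?C then walk_series N K c t *\<^sub>R b else undefined)" for t
  have series0: "walk_series N K a 0 = indicator K a" for a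
    using powser_zero[of "\<lambda>n. walk_count N K n a / fact n"] by (simp add: walk_series_def)
  note K_iff = in_class_iff[OF R K]
  have "x 0 \<in> polydiagonal ?C R"
    using K_iff equiv_type[OF R]
    by (auto simp: polydiagonal_def phase_space_def x_def series0 indicator_def)
  moreover have "solution_on ?C F UNIV x"
    unfolding solution_on_def
  proof safe
    fix t a assume a: "a \<in> ?C"
    have "((\<lambda>s. walk_series N K a s *\<^sub>R b) has_vector_derivative
        (\<Sum>e\<in>input_edges N a. walk_series N K (tail_cell N e) t) *\<^sub>R b) (at t)"
      using walk_series_has_derivative[OF N, of K a t]
      by (auto intro!: derivative_eq_intros simp: has_real_derivative_iff_has_vector_derivative)
    moreover have "F (x t) a = (\<Sum>e\<in>input_edges N a. walk_series N K (tail_cell N e) t) *\<^sub>R b"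
      unfolding F_def scaleR_sum_left
      by (rule sum.cong) (use homogeneous_simps(6)[OF N] in \<open>auto simp: x_def\<close>)
    ultimately show "((\<lambda>s. x s a) has_vector_derivative F (x t) a) (at t)"
      using a by (simp add: x_def)
  qed (auto simp: phase_space_def x_def)
  moreover have "flow_invariant ?C F (polydiagonal ?C R)"
    using inv[OF input_sum_admissible[OF N]] by (simp add: F_def[abs_def])
  ultimately have "x t \<in> polydiagonal ?C R" for t
    unfolding flow_invariant_def by (metis UNIV_I is_interval_univ)
  then have "walk_series N K c t *\<^sub>R b = walk_series N K d t *\<^sub>R b" for t
    using cd cells by (fastforce simp: polydiagonal_def x_def)
  then have "walk_series N K c = walk_series N K d"
    using nonzero_Basis[OF b] by (simp add: fun_eq_iff)
  then have "(\<Sum>e\<in>input_edges N c. walk_series N K (tail_cell N e) 0)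
      = (\<Sum>e\<in>input_edges N d. walk_series N K (tail_cell N e) 0)"
    using walk_series_has_derivative[OF N] by (metis DERIV_unique)
  moreover have "(\<Sum>e\<in>input_edges N a. walk_series N K (tail_cell N e) 0)
      = real (input_count N a K)" for a
    using homogeneous_simps(3)[OF N, of a]
    by (simp add: series0 indicator_def input_count_def sum.If_cases Int_def)
  ultimately show "input_count N c K = input_count N d K" by simp
qed

lemma polydiagonal_mem_synchrony_iff:
  assumes "homogeneous N" and "equiv (cells N) R"
  shows "(polydiagonal (cells N) R :: ('a \<Rightarrow> 'v::euclidean_space) set) \<in> synchrony_subspaces N
    \<longleftrightarrow> balanced N R"
  using flow_invariant_imp_balanced[OF assms] balanced_imp_flow_invariant[OF assms] assms(2)
  unfolding synchrony_subspaces_def by blast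

section \<open>Polydiagonal subspaces and their relations\<close>

text \<open>
  The function that is a nonzero vector on the \<open>R\<close>-class of \<open>c\<close> and zero elsewhere separates
  \<open>c\<close> from every cell not related to it.
\<close>
lemma polydiagonal_subset_iff:
  assumes R: "equiv C R" and R': "R' \<subseteq> C \<times> C"
  shows "(polydiagonal C R :: ('a \<Rightarrow> 'v::euclidean_space) set) \<subseteq> polydiagonal C R' \<longleftrightarrow> R' \<subseteq> R"
proof
  assume sub: "(polydiagonal C R :: ('a \<Rightarrow> 'v) set) \<subseteq> polydiagonal C R'"
  obtain b :: 'v where b: "b \<in> Basis" using nonempty_Basis by blast
  show "R' \<subseteq> R"
  proof safe
    fix c d assume cd: "(c, d) \<in> R'"
    define x where "x a = (if a \<in> C then if (c, a) \<in> R then b else 0 else undefined)" for a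
    have "(c, a) \<in> R \<longleftrightarrow> (c, a') \<in> R" if "(a, a') \<in> R" for a a'
      using R that by (meson equiv_def symE transE)
    then have "x \<in> polydiagonal C R"
      using equiv_type[OF R] by (auto simp: polydiagonal_def phase_space_def x_def)
    then have "x c = x d" using sub cd by (auto simp: polydiagonal_def)
    moreover have "c \<in> C" "d \<in> C" using cd R' by auto
    moreover have "(c, c) \<in> R" using R \<open>c \<in> C\<close> by (simp add: equiv_def refl_on_def)
    ultimately show "(c, d) \<in> R" using b by (auto simp: x_def split: if_splits)
  qed
qed (auto simp: polydiagonal_def)

lemma polydiagonal_eq_iff:
  assumes "equiv C R" and "equiv C R'"
  shows "(polydiagonal C R :: ('a \<Rightarrow> 'v::euclidean_space) set) = polydiagonal C R' \<longleftrightarrow> R = R'"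
  using polydiagonal_subset_iff[OF assms(1) equiv_type[OF assms(2)], where 'v = 'v]
    polydiagonal_subset_iff[OF assms(2) equiv_type[OF assms(1)], where 'v = 'v] by blast

lemma equiv_Id_on: "equiv C (Id_on C)"
  by (auto simp: equiv_def refl_on_def sym_def trans_def)

lemma polydiagonal_Id_on: "polydiagonal C (Id_on C) = phase_space C"
  by (auto simp: polydiagonal_def)

lemma synchrony_type_iffs:
  assumes N: "homogeneous N" and R: "equiv (cells N) R"
  shows "(polydiagonal (cells N) R :: ('a \<Rightarrow> 'v::euclidean_space) set)
      \<in> nonbipartite_synchrony N C1 C2 \<longleftrightarrow> balanced N R \<and> \<not> bipartite C1 C2 R" (is ?nb)
    and "(polydiagonal (cells N) R :: ('a \<Rightarrow> 'v) set)
      \<in> pairing_synchrony N C1 C2 \<longleftrightarrow> balanced N R \<and> bipartite C1 C2 R \<and> pairing C1 C2 R" (is ?pb)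
    and "(polydiagonal (cells N) R :: ('a \<Rightarrow> 'v) set)
      \<in> nonpairing_synchrony N C1 C2 \<longleftrightarrow>
        balanced N R \<and> bipartite C1 C2 R \<and> \<not> pairing C1 C2 R" (is ?npb)
proof -
  have unique: "(\<exists>R'. equiv (cells N) R' \<and>
      (polydiagonal (cells N) R :: ('a \<Rightarrow> 'v) set) = polydiagonal (cells N) R' \<and> P R') \<longleftrightarrow> P R"
    for P
    using polydiagonal_eq_iff[OF R, where 'v = 'v] R by metis
  show ?nb ?pb ?npb
    unfolding nonbipartite_synchrony_def pairing_synchrony_def nonpairing_synchrony_def
      mem_Collect_eq unique polydiagonal_mem_synchrony_iff[OF N R] by blast+
qed

lemma bipartite_iff:
  assumes "equiv (C1 \<union> C2) R"
  shows "bipartite C1 C2 R \<longleftrightarrow> (\<exists>c\<in>C1. \<exists>d\<in>C2. (c, d) \<in> R)"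
proof
  assume "bipartite C1 C2 R"
  then obtain K c d where "K \<in> (C1 \<union> C2) // R" "c \<in> K" "c \<in> C1" "d \<in> K" "d \<in> C2"
    unfolding bipartite_def by blast
  then show "\<exists>c\<in>C1. \<exists>d\<in>C2. (c, d) \<in> R"
    using quotient_eq_iff[OF assms, of K K c d] by blast
next
  assume "\<exists>c\<in>C1. \<exists>d\<in>C2. (c, d) \<in> R"
  then obtain c d where cd: "c \<in> C1" "d \<in> C2" "(c, d) \<in> R" by blast
  then have "R `` {c} \<in> (C1 \<union> C2) // R" "c \<in> R `` {c}" "d \<in> R `` {c}"
    using assms by (auto intro: quotientI simp: equiv_def refl_on_def)
  with cd(1,2) have "R `` {c} \<inter> C1 \<noteq> {} \<and> R `` {c} \<inter> C2 \<noteq> {}" by auto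
  with \<open>R `` {c} \<in> (C1 \<union> C2) // R\<close> show "bipartite C1 C2 R" unfolding bipartite_def by (rule bexI[rotated])
qed

lemma pairing_iff:
  assumes R: "equiv (C1 \<union> C2) R" and disj: "C1 \<inter> C2 = {}"
  shows "pairing C1 C2 R \<longleftrightarrow>
    (\<forall>(c, d) \<in> R. c \<in> C1 \<and> d \<in> C1 \<or> c \<in> C2 \<and> d \<in> C2 \<longrightarrow> c = d)"
proof
  assume p: "pairing C1 C2 R"
  show "\<forall>(c, d) \<in> R. c \<in> C1 \<and> d \<in> C1 \<or> c \<in> C2 \<and> d \<in> C2 \<longrightarrow> c = d"
  proof clarify
    fix c d assume cd: "(c, d) \<in> R" "c \<in> C1 \<and> d \<in> C1 \<or> c \<in> C2 \<and> d \<in> C2"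
    then have K: "R `` {c} \<in> (C1 \<union> C2) // R" "c \<in> R `` {c}" "d \<in> R `` {c}"
      using R by (auto intro: quotientI simp: equiv_def refl_on_def)
    with p have "(\<exists>a. R `` {c} = {a}) \<or> (\<exists>a\<in>C1. \<exists>b\<in>C2. R `` {c} = {a, b})"
      unfolding pairing_def by blast
    then show "c = d"
    proof
      assume "\<exists>a. R `` {c} = {a}"
      with K(2,3) show ?thesis by (metis singletonD)
    next
      assume "\<exists>a\<in>C1. \<exists>b\<in>C2. R `` {c} = {a, b}"
      then obtain a b where "a \<in> C1" "b \<in> C2" "c \<in> {a, b}" "d \<in> {a, b}"
        using K(2,3) by metis
      with cd(2) disj show ?thesis by blast
    qed
  qed
next
  assume same: "\<forall>(c, d) \<in> R. c \<in> C1 \<and> d \<in> C1 \<or> c \<in> C2 \<and> d \<in> C2 \<longrightarrow> c = d"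
  show "pairing C1 C2 R"
    unfolding pairing_def
  proof
    fix K assume K: "K \<in> (C1 \<union> C2) // R"
    have rel: "(a, b) \<in> R" if "a \<in> K" "b \<in> K" for a b
      using quotient_eq_iff[OF R K K that] by simp
    have sub: "K \<subseteq> C1 \<union> C2" using K R by (metis Union_quotient Union_upper)
    obtain a where a: "a \<in> K" using in_quotient_imp_non_empty[OF R K] by blast
    show "(\<exists>c. K = {c}) \<or> (\<exists>c\<in>C1. \<exists>d\<in>C2. K = {c, d})"
    proof (cases "K = {a}")
      case False
      with a obtain b where b: "b \<in> K" "b \<noteq> a" by blast
      have one: "x = y" if "x \<in> K" "y \<in> K" "x \<in> C1 \<and> y \<in> C1 \<or> x \<in> C2 \<and> y \<in> C2" for x y
        using rel[OF that(1,2)] same that(3) by auto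
      have side: "x \<in> C1 \<or> x \<in> C2" if "x \<in> K" for x using that sub by blast
      have sides: "a \<in> C1 \<and> b \<in> C2 \<or> b \<in> C1 \<and> a \<in> C2"
        using one[OF a b(1)] b(2) side[OF a] side[OF b(1)] by metis
      have "x = a \<or> x = b" if "x \<in> K" for x
        using one[OF that a] one[OF that b(1)] side[OF that] sides by metis
      with a b(1) have "K = {a, b}" by auto
      moreover have "{a, b} = {b, a}" by auto
      ultimately show ?thesis using sides by metis
    qed blast
  qed
qed

section \<open>Balance on a disjoint union\<close>

text \<open>
  Unions of classes; counting from these instead of from single classes avoids comparing the
  classes of different relations.
\<close>
definition saturated :: "'a rel \<Rightarrow> 'a set \<Rightarrow> bool" where
  "saturated R U \<longleftrightarrow> (\<forall>(a, b) \<in> R. a \<in> U \<longleftrightarrow> b \<in> U)"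

lemma balanced_iff_saturated:
  assumes N: "homogeneous N" and R: "equiv (cells N) R"
  shows "balanced N R \<longleftrightarrow>
    (\<forall>(c, d) \<in> R. \<forall>U. saturated R U \<longrightarrow> input_count N c U = input_count N d U)"
proof
  assume bal: "balanced N R"
  show "\<forall>(c, d) \<in> R. \<forall>U. saturated R U \<longrightarrow> input_count N c U = input_count N d U"
  proof clarify
    fix c d U assume cd: "(c, d) \<in> R" and U: "saturated R U"
    obtain \<beta> where \<beta>: "bij_betw \<beta> (input_edges N c) (input_edges N d)"
      "\<forall>e \<in> input_edges N c. (tail_cell N e, tail_cell N (\<beta> e)) \<in> R"
      using balanced_imp_class_preserving_isomorphism[OF N R bal cd]
      by (auto simp: input_isomorphism_def)
    have tail: "tail_cell N e \<in> U \<longleftrightarrow> tail_cell N (\<beta> e) \<in> U" if "e \<in> input_edges N c" for e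
      using \<beta>(2) that U by (auto simp: saturated_def)
    have "bij_betw \<beta> {e \<in> input_edges N c. tail_cell N e \<in> U}
        {e \<in> input_edges N d. tail_cell N e \<in> U}"
    proof (rule bij_betw_subset[OF \<beta>(1)])
      show "\<beta> ` {e \<in> input_edges N c. tail_cell N e \<in> U}
          = {e \<in> input_edges N d. tail_cell N e \<in> U}"
        using tail bij_betw_imp_surj_on[OF \<beta>(1), symmetric] by auto
    qed auto
    then show "input_count N c U = input_count N d U"
      unfolding input_count_def by (rule bij_betw_same_card)
  qed
next
  assume sat: "\<forall>(c, d) \<in> R. \<forall>U. saturated R U \<longrightarrow> input_count N c U = input_count N d U"
  have "saturated R K" if "K \<in> cells N // R" for K
    unfolding saturated_def using in_class_iff[OF R that] by blast
  with sat show "balanced N R" unfolding balanced_def by blast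
qed

lemma balanced_saturatedD:
  assumes "homogeneous N" and "equiv (cells N) R" and "balanced N R"
    and "(c, d) \<in> R" and "saturated R U"
  shows "input_count N c U = input_count N d U"
  using balanced_iff_saturated[OF assms(1,2)] assms(3-5) by auto

lemma balanced_saturatedI:
  assumes "homogeneous N" and "equiv (cells N) R"
    and "\<And>c d U. (c, d) \<in> R \<Longrightarrow> saturated R U \<Longrightarrow> input_count N c U = input_count N d U"
  shows "balanced N R"
  using balanced_iff_saturated[OF assms(1,2)] assms(3) by auto

lemma input_count_UNIV: "input_count N c UNIV = in_degree (digr N) c"
  by (simp add: input_count_def in_degree_def del: in_in_arcs_conv)

lemma input_count_Int:
  assumes "homogeneous N"
  shows "input_count N c (U \<inter> cells N) = input_count N c U"
  using homogeneous_simps(6)[OF assms] by (auto simp: input_count_def intro!: arg_cong[where f = card])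

lemma regular_network_homogeneous: "regular_network N v \<Longrightarrow> homogeneous N"
  by (simp add: regular_network_def coupled_cell_network_def homogeneous_def)

lemma disjoint_union_homogeneous:
  assumes "homogeneous N1" and "homogeneous N2"
  shows "homogeneous (disjoint_union N1 N2)"
proof -
  note simps = homogeneous_simps[OF assms(1)] homogeneous_simps[OF assms(2)]
  have "fin_digraph (digr (disjoint_union N1 N2))"
    by unfold_locales (use simps in \<open>auto simp: disjoint_union_def\<close>)
  then show ?thesis by (simp add: homogeneous_def disjoint_union_def)
qed

lemma cells_disjoint_union [simp]: "cells (disjoint_union N1 N2) = cells N1 \<union> cells N2"
  by (simp add: disjoint_union_def)

lemma input_count_disjoint_union:
  assumes N1: "homogeneous N1" and N2: "homogeneous N2" and disj: "cells N1 \<inter> cells N2 = {}"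
  shows "c \<in> cells N1 \<Longrightarrow> input_count (disjoint_union N1 N2) c U = input_count N1 c U"
    and "c \<in> cells N2 \<Longrightarrow> input_count (disjoint_union N1 N2) c U = input_count N2 c U"
proof -
  let ?N = "disjoint_union N1 N2"
  have heads: "e \<in> edges N1 \<Longrightarrow> head_cell N1 e \<notin> cells N2"
    "e' \<in> edges N2 \<Longrightarrow> head_cell N2 e' \<notin> cells N1" for e e'
    using homogeneous_simps(5)[OF N1] homogeneous_simps(5)[OF N2] disj by blast+
  have "{e \<in> input_edges ?N c. tail_cell ?N e \<in> U}
      = Inl ` {e \<in> input_edges N1 c. tail_cell N1 e \<in> U}" if "c \<in> cells N1"
    using that heads by (auto simp: disjoint_union_def in_arcs_def)
  then show "c \<in> cells N1 \<Longrightarrow> input_count ?N c U = input_count N1 c U"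
    by (simp add: input_count_def card_image del: in_in_arcs_conv)
  have "{e \<in> input_edges ?N c. tail_cell ?N e \<in> U}
      = Inr ` {e \<in> input_edges N2 c. tail_cell N2 e \<in> U}" if "c \<in> cells N2"
    using that heads by (auto simp: disjoint_union_def in_arcs_def)
  then show "c \<in> cells N2 \<Longrightarrow> input_count ?N c U = input_count N2 c U"
    by (simp add: input_count_def card_image del: in_in_arcs_conv)
qed

lemma balanced_union_iff:
  assumes N1: "homogeneous N1" and N2: "homogeneous N2" and disj: "cells N1 \<inter> cells N2 = {}"
    and R1: "equiv (cells N1) R1" and R2: "equiv (cells N2) R2"
  shows "equiv (cells N1 \<union> cells N2) (R1 \<union> R2)"
    and "balanced (disjoint_union N1 N2) (R1 \<union> R2) \<longleftrightarrow> balanced N1 R1 \<and> balanced N2 R2"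
proof -
  let ?N = "disjoint_union N1 N2"
  note types = equiv_type[OF R1] equiv_type[OF R2]
  show eq: "equiv (cells N1 \<union> cells N2) (R1 \<union> R2)"
  proof (rule equivI)
    show "R1 \<union> R2 \<subseteq> (cells N1 \<union> cells N2) \<times> (cells N1 \<union> cells N2)" using types by blast
    show "refl_on (cells N1 \<union> cells N2) (R1 \<union> R2)"
      using R1 R2 by (auto simp: equiv_def refl_on_def)
    show "sym (R1 \<union> R2)" using R1 R2 by (auto simp: equiv_def sym_def)
    show "trans (R1 \<union> R2)"
    proof (rule transI)
      fix a b c assume ab: "(a, b) \<in> R1 \<union> R2" and bc: "(b, c) \<in> R1 \<union> R2"
      then have "(a, b) \<in> R1 \<and> (b, c) \<in> R1 \<or> (a, b) \<in> R2 \<and> (b, c) \<in> R2"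
        using types disj by blast
      then show "(a, c) \<in> R1 \<union> R2" using R1 R2 by (auto simp: equiv_def dest: transD)
    qed
  qed
  note N = disjoint_union_homogeneous[OF N1 N2]
  have eqN: "equiv (cells ?N) (R1 \<union> R2)" using eq by simp
  have count: "c \<in> cells N1 \<Longrightarrow> input_count ?N c U = input_count N1 c U"
    "c \<in> cells N2 \<Longrightarrow> input_count ?N c U = input_count N2 c U" for c U
    using input_count_disjoint_union[OF N1 N2 disj] by blast+
  have sat: "saturated (R1 \<union> R2) (U \<inter> cells N1)" if "saturated R1 U" for U
    using that types disj unfolding saturated_def by blast
  have sat': "saturated (R1 \<union> R2) (U \<inter> cells N2)" if "saturated R2 U" for U
    using that types disj unfolding saturated_def by blast
  show "balanced ?N (R1 \<union> R2) \<longleftrightarrow> balanced N1 R1 \<and> balanced N2 R2"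
  proof (intro iffI conjI)
    assume bal: "balanced ?N (R1 \<union> R2)"
    show "balanced N1 R1"
    proof (rule balanced_saturatedI[OF N1 R1])
      fix c d U assume cd: "(c, d) \<in> R1" and U: "saturated R1 U"
      have "input_count ?N c (U \<inter> cells N1) = input_count ?N d (U \<inter> cells N1)"
        using balanced_saturatedD[OF N eqN bal _ sat[OF U]] cd by blast
      moreover have "c \<in> cells N1" "d \<in> cells N1" using types(1) cd by auto
      ultimately show "input_count N1 c U = input_count N1 d U"
        by (simp add: count input_count_Int[OF N1])
    qed
    show "balanced N2 R2"
    proof (rule balanced_saturatedI[OF N2 R2])
      fix c d U assume cd: "(c, d) \<in> R2" and U: "saturated R2 U"
      have "input_count ?N c (U \<inter> cells N2) = input_count ?N d (U \<inter> cells N2)"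
        using balanced_saturatedD[OF N eqN bal _ sat'[OF U]] cd by blast
      moreover have "c \<in> cells N2" "d \<in> cells N2" using types(2) cd by auto
      ultimately show "input_count N2 c U = input_count N2 d U"
        by (simp add: count input_count_Int[OF N2])
    qed
  next
    assume bal: "balanced N1 R1 \<and> balanced N2 R2"
    show "balanced ?N (R1 \<union> R2)"
    proof (rule balanced_saturatedI[OF N eqN])
      fix c d U assume cd: "(c, d) \<in> R1 \<union> R2" and U: "saturated (R1 \<union> R2) U"
      have sat12: "saturated R1 U" "saturated R2 U" using U by (auto simp: saturated_def)
      from cd show "input_count ?N c U = input_count ?N d U"
      proof
        assume cd: "(c, d) \<in> R1"
        then have "c \<in> cells N1" "d \<in> cells N1" using types(1) by auto
        with balanced_saturatedD[OF N1 R1 _ cd sat12(1)] bal show ?thesis by (simp add: count)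
      next
        assume cd: "(c, d) \<in> R2"
        then have "c \<in> cells N2" "d \<in> cells N2" using types(2) by auto
        with balanced_saturatedD[OF N2 R2 _ cd sat12(2)] bal show ?thesis by (simp add: count)
      qed
    qed
  qed
qed

text \<open>The set \<open>UNIV\<close> is saturated, and the count from it is the valency.\<close>
lemma bipartite_balanced_imp_same_valency:
  assumes N1: "regular_network N1 v1" and N2: "regular_network N2 v2"
    and disj: "cells N1 \<inter> cells N2 = {}" and R: "equiv (cells N1 \<union> cells N2) R"
    and bal: "balanced (disjoint_union N1 N2) R" and bip: "bipartite (cells N1) (cells N2) R"
  shows "v1 = v2"
proof -
  note h = regular_network_homogeneous[OF N1] regular_network_homogeneous[OF N2]
  obtain c d where cd: "c \<in> cells N1" "d \<in> cells N2" "(c, d) \<in> R"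
    using bip bipartite_iff[OF R] by blast
  have "input_count (disjoint_union N1 N2) c UNIV = input_count (disjoint_union N1 N2) d UNIV"
    using balanced_saturatedD[OF disjoint_union_homogeneous[OF h] _ bal cd(3)] R
    by (simp add: saturated_def)
  moreover have "input_count N1 c UNIV = v1" "input_count N2 d UNIV = v2"
    using N1 N2 cd by (auto simp: input_count_UNIV regular_network_def)
  ultimately show ?thesis
    using cd input_count_disjoint_union[OF h disj] by simp
qed

section \<open>Quotients and lifts\<close>

definition lifted_rel :: "'a set \<Rightarrow> 'a rel \<Rightarrow> 'a set rel \<Rightarrow> 'a rel" where
  "lifted_rel C R RQ = {(c, d). c \<in> C \<and> d \<in> C \<and> (R `` {c}, R `` {d}) \<in> RQ}"

lemma lifted_rel_iff:
  "(c, d) \<in> lifted_rel C R RQ \<longleftrightarrow> c \<in> C \<and> d \<in> C \<and> (R `` {c}, R `` {d}) \<in> RQ"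
  by (simp add: lifted_rel_def)

lemma equiv_lifted_rel:
  assumes R: "equiv C R" and RQ: "equiv (C // R) RQ"
  shows "equiv C (lifted_rel C R RQ)" and "R \<subseteq> lifted_rel C R RQ"
proof -
  have refl: "(R `` {c}, R `` {c}) \<in> RQ" if "c \<in> C" for c
    using RQ quotientI[OF that, of R] by (auto simp: equiv_def refl_on_def)
  show "equiv C (lifted_rel C R RQ)"
  proof (rule equivI)
    show "lifted_rel C R RQ \<subseteq> C \<times> C" by (auto simp: lifted_rel_def)
    show "refl_on C (lifted_rel C R RQ)" using refl by (auto simp: refl_on_def lifted_rel_iff)
    show "sym (lifted_rel C R RQ)"
      using RQ by (auto simp: lifted_rel_iff equiv_def intro!: symI dest: symD)
    show "trans (lifted_rel C R RQ)"
      using RQ by (auto simp: lifted_rel_iff equiv_def intro!: transI dest: transD)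
  qed
  show "R \<subseteq> lifted_rel C R RQ"
  proof safe
    fix c d assume cd: "(c, d) \<in> R"
    then have "c \<in> C" "d \<in> C" using equiv_type[OF R] by auto
    with refl equiv_class_eq[OF R cd] show "(c, d) \<in> lifted_rel C R RQ"
      by (simp add: lifted_rel_iff)
  qed
qed

lemma lift_eq_polydiagonal:
  assumes "equiv C R" and "equiv (C // R) RQ"
  shows "lift C R RQ = polydiagonal C (lifted_rel C R RQ)"
  using equiv_lifted_rel(2)[OF assms]
  by (simp add: lift_def lifted_rel_def[symmetric] Un_absorb1)

lemma bipartite_lifted_rel_iff:
  assumes R: "equiv (C1 \<union> C2) R" and RQ: "equiv ((C1 \<union> C2) // R) RQ"
  shows "bipartite (C1 // R) (C2 // R) RQ \<longleftrightarrow> bipartite C1 C2 (lifted_rel (C1 \<union> C2) R RQ)"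
proof -
  have "C1 // R \<union> C2 // R = (C1 \<union> C2) // R" by (auto simp: quotient_def)
  then have "bipartite (C1 // R) (C2 // R) RQ \<longleftrightarrow>
      (\<exists>X\<in>C1 // R. \<exists>Y\<in>C2 // R. (X, Y) \<in> RQ)"
    using bipartite_iff[of "C1 // R" "C2 // R" RQ] RQ by simp
  also have "\<dots> \<longleftrightarrow> (\<exists>c\<in>C1. \<exists>d\<in>C2. (c, d) \<in> lifted_rel (C1 \<union> C2) R RQ)"
    by (auto simp: lifted_rel_iff quotient_def)
  also have "\<dots> \<longleftrightarrow> bipartite C1 C2 (lifted_rel (C1 \<union> C2) R RQ)"
    using bipartite_iff[OF equiv_lifted_rel(1)[OF R RQ]] by simp
  finally show ?thesis .
qed

lemma cells_quotient_network [simp]: "cells (quotient_network N R) = cells N // R"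
  by (simp add: quotient_network_def)

lemma some_in_class:
  assumes "equiv C R" and "K \<in> C // R"
  shows "(SOME c. c \<in> K) \<in> K"
  using in_quotient_imp_non_empty[OF assms] by (simp add: some_in_eq)

lemma quotient_network_homogeneous:
  assumes N: "homogeneous N" and R: "equiv (cells N) R"
  shows "homogeneous (quotient_network N R)"
proof -
  let ?Q = "quotient_network N R"
  note simps = homogeneous_simps[OF N]
  have sub: "quotient_edges N R \<subseteq> edges N"
    by (auto simp: quotient_edges_def)
  have "fin_digraph (digr ?Q)"
    by unfold_locales
      (use sub simps in \<open>auto simp: quotient_network_def intro!: quotientI
        intro: finite_subset finite_quotient[OF _ equiv_type[OF R]]\<close>)
  moreover have "cell_type ?Q = cells ?Q \<times> cells ?Q"
    using N by (auto simp: quotient_network_def homogeneous_def quotient_def)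
  moreover have "edge_type ?Q = edges ?Q \<times> edges ?Q"
    using N sub by (auto simp: quotient_network_def homogeneous_def)
  ultimately show ?thesis by (simp add: homogeneous_def)
qed

text \<open>
  The quotient is built from the input edges of chosen representatives. Balance lets the
  representative be replaced by any cell of the class, since the cells whose class belongs to
  \<open>\<U>\<close> form a saturated set.
\<close>
lemma input_count_quotient:
  assumes N: "homogeneous N" and R: "equiv (cells N) R" and bal: "balanced N R"
    and c: "c \<in> cells N"
  shows "input_count (quotient_network N R) (R `` {c}) \<U>
    = input_count N c {a \<in> cells N. R `` {a} \<in> \<U>}"
proof -
  let ?Q = "quotient_network N R" and ?X = "R `` {c}"
  let ?U = "{a \<in> cells N. R `` {a} \<in> \<U>}"
  define r where "r K = (SOME c. c \<in> K)" for K :: "'a set"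
  have X: "?X \<in> cells N // R" using c by (rule quotientI)
  have r: "r K \<in> K" if "K \<in> cells N // R" for K
    unfolding r_def using some_in_class[OF R that] .
  have edges: "e \<in> edges ?Q \<and> head_cell ?Q e = ?X \<longleftrightarrow> e \<in> input_edges N (r ?X)" for e
  proof
    assume "e \<in> edges ?Q \<and> head_cell ?Q e = ?X"
    then obtain K where K: "K \<in> cells N // R" "e \<in> input_edges N (r K)"
      and e: "R `` {head_cell N e} = ?X"
      by (auto simp: quotient_network_def quotient_edges_def r_def)
    have "R `` {r K} = K" by (rule class_eqI[OF R K(1) r[OF K(1)]])
    then show "e \<in> input_edges N (r ?X)" using K(2) e by auto
  next
    assume e: "e \<in> input_edges N (r ?X)"
    then have "e \<in> quotient_edges N R"
      unfolding quotient_edges_def r_def[symmetric] using X by blast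
    then have "e \<in> edges ?Q" by (simp add: quotient_network_def)
    moreover have "head_cell ?Q e = ?X"
      using e class_eqI[OF R X r[OF X]] by (auto simp: quotient_network_def)
    ultimately show "e \<in> edges ?Q \<and> head_cell ?Q e = ?X" ..
  qed
  have "{e \<in> input_edges ?Q ?X. tail_cell ?Q e \<in> \<U>} = {e \<in> input_edges N (r ?X). tail_cell N e \<in> ?U}"
  proof (intro Collect_cong)
    fix e
    have "e \<in> input_edges ?Q ?X \<longleftrightarrow> e \<in> input_edges N (r ?X)"
      using edges[of e] by simp
    moreover have "tail_cell ?Q e \<in> \<U> \<longleftrightarrow> tail_cell N e \<in> ?U" if "e \<in> input_edges N (r ?X)"
      using homogeneous_simps(6)[OF N that] by (simp add: quotient_network_def)
    ultimately show "e \<in> input_edges ?Q ?X \<and> tail_cell ?Q e \<in> \<U>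
        \<longleftrightarrow> e \<in> input_edges N (r ?X) \<and> tail_cell N e \<in> ?U" by blast
  qed
  then have "input_count ?Q ?X \<U> = input_count N (r ?X) ?U"
    by (simp add: input_count_def)
  also have "\<dots> = input_count N c ?U"
  proof (rule balanced_saturatedD[OF N R bal, symmetric])
    show "(c, r ?X) \<in> R" using r[OF X] by simp
    show "saturated R ?U"
      using equiv_class_eq[OF R] equiv_type[OF R] by (auto simp: saturated_def)
  qed
  finally show ?thesis .
qed

text \<open>
  The saturated sets of the lifted relation correspond to those of \<open>RQ\<close>, and corresponding sets
  have the same input counts.
\<close>
lemma balanced_lifted_rel_iff:
  assumes N: "homogeneous N" and R: "equiv (cells N) R" and bal: "balanced N R"
    and RQ: "equiv (cells N // R) RQ"
  shows "balanced (quotient_network N R) RQ \<longleftrightarrow> balanced N (lifted_rel (cells N) R RQ)"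
proof -
  let ?Q = "quotient_network N R" and ?L = "lifted_rel (cells N) R RQ"
  note Q = quotient_network_homogeneous[OF N R]
  note L = equiv_lifted_rel[OF R RQ]
  have eqQ: "equiv (cells ?Q) RQ" using RQ by simp
  note count = input_count_quotient[OF N R bal]
  show ?thesis
  proof
    assume balQ: "balanced ?Q RQ"
    show "balanced N ?L"
    proof (rule balanced_saturatedI[OF N L(1)])
      fix c d U assume cd: "(c, d) \<in> ?L" and U: "saturated ?L U"
      let ?\<U> = "(\<lambda>a. R `` {a}) ` (U \<inter> cells N)"
      have mem: "R `` {a} \<in> ?\<U> \<longleftrightarrow> a \<in> U" if "a \<in> cells N" for a
      proof
        assume "R `` {a} \<in> ?\<U>"
        then obtain b where b: "b \<in> U" "b \<in> cells N" "R `` {a} = R `` {b}" by blast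
        then have "(a, b) \<in> ?L" using eq_equiv_class[OF b(3) R b(2)] L(2) by blast
        then show "a \<in> U" using U b(1) by (auto simp: saturated_def)
      qed (use that in blast)
      have "saturated RQ ?\<U>"
        unfolding saturated_def
      proof clarify
        fix X Y assume XY: "(X, Y) \<in> RQ"
        then have "X \<in> cells N // R" "Y \<in> cells N // R" using equiv_type[OF RQ] by auto
        then obtain a b where ab: "a \<in> cells N" "X = R `` {a}" "b \<in> cells N" "Y = R `` {b}"
          by (auto elim!: quotientE)
        then have "(a, b) \<in> ?L" using XY by (simp add: lifted_rel_iff)
        then have "a \<in> U \<longleftrightarrow> b \<in> U" using U by (auto simp: saturated_def)
        then show "X \<in> ?\<U> \<longleftrightarrow> Y \<in> ?\<U>" using mem ab by blast
      qed
      moreover have cd': "c \<in> cells N" "d \<in> cells N" "(R `` {c}, R `` {d}) \<in> RQ"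
        using cd by (simp_all add: lifted_rel_iff)
      ultimately have "input_count ?Q (R `` {c}) ?\<U> = input_count ?Q (R `` {d}) ?\<U>"
        by (intro balanced_saturatedD[OF Q eqQ balQ])
      moreover have "{a \<in> cells N. R `` {a} \<in> ?\<U>} = U \<inter> cells N" using mem by blast
      ultimately show "input_count N c U = input_count N d U"
        using cd' by (simp add: count input_count_Int[OF N])
    qed
  next
    assume balL: "balanced N ?L"
    show "balanced ?Q RQ"
    proof (rule balanced_saturatedI[OF Q eqQ])
      fix X Y \<U> assume XY: "(X, Y) \<in> RQ" and U: "saturated RQ \<U>"
      then have "X \<in> cells N // R" "Y \<in> cells N // R" using equiv_type[OF RQ] by auto
      then obtain a b where ab: "a \<in> cells N" "X = R `` {a}" "b \<in> cells N" "Y = R `` {b}"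
        by (auto elim!: quotientE)
      have "saturated ?L {a \<in> cells N. R `` {a} \<in> \<U>}"
        using U by (auto simp: saturated_def lifted_rel_iff)
      moreover have "(a, b) \<in> ?L" using XY ab by (simp add: lifted_rel_iff)
      ultimately show "input_count ?Q X \<U> = input_count ?Q Y \<U>"
        using ab balanced_saturatedD[OF N L(1) balL] by (simp add: count)
    qed
  qed
qed

section \<open>Relations that join the two parts\<close>

definition same_side :: "'a set \<Rightarrow> 'a set \<Rightarrow> 'a rel" where
  "same_side C1 C2 = C1 \<times> C1 \<union> C2 \<times> C2"

lemma equiv_Int_same_side:
  assumes R: "equiv (C1 \<union> C2) R" and disj: "C1 \<inter> C2 = {}"
  shows "equiv (C1 \<union> C2) (R \<inter> same_side C1 C2)"
proof (rule equivI)
  show "R \<inter> same_side C1 C2 \<subseteq> (C1 \<union> C2) \<times> (C1 \<union> C2)" using equiv_type[OF R] by blast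
  show "refl_on (C1 \<union> C2) (R \<inter> same_side C1 C2)"
    using R by (auto simp: equiv_def refl_on_def same_side_def)
  show "sym (R \<inter> same_side C1 C2)"
    using R by (auto simp: equiv_def same_side_def intro!: symI dest: symD)
  show "trans (R \<inter> same_side C1 C2)"
  proof (rule transI)
    fix a b c assume "(a, b) \<in> R \<inter> same_side C1 C2" "(b, c) \<in> R \<inter> same_side C1 C2"
    moreover from this have "(a, c) \<in> R" using R by (auto simp: equiv_def dest: transD)
    ultimately show "(a, c) \<in> R \<inter> same_side C1 C2" using disj by (auto simp: same_side_def)
  qed
qed

lemma not_bipartite_iff_same_side:
  assumes R: "equiv (C1 \<union> C2) R" and disj: "C1 \<inter> C2 = {}"
  shows "\<not> bipartite C1 C2 R \<longleftrightarrow> R \<subseteq> same_side C1 C2"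
proof
  assume nb: "\<not> bipartite C1 C2 R"
  show "R \<subseteq> same_side C1 C2"
  proof safe
    fix c d assume cd: "(c, d) \<in> R"
    then have "(d, c) \<in> R" using R by (meson equiv_def symE)
    with cd nb equiv_type[OF R] show "(c, d) \<in> same_side C1 C2"
      unfolding bipartite_iff[OF R] same_side_def by blast
  qed
next
  assume "R \<subseteq> same_side C1 C2"
  with disj show "\<not> bipartite C1 C2 R"
    unfolding bipartite_iff[OF R] same_side_def by blast
qed

text \<open>
  If \<open>U\<close> is saturated for the restricted relation and \<open>D\<close> is the side of the two cells, then the
  \<open>R\<close>-saturation of \<open>U \<inter> D\<close> does not add cells of \<open>D\<close>, and the two cells receive edges from \<open>D\<close>
  only.
\<close>
lemma balanced_Int_same_side:
  assumes N1: "homogeneous N1" and N2: "homogeneous N2" and disj: "cells N1 \<inter> cells N2 = {}"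
    and R: "equiv (cells N1 \<union> cells N2) R" and bal: "balanced (disjoint_union N1 N2) R"
  shows "balanced (disjoint_union N1 N2) (R \<inter> same_side (cells N1) (cells N2))"
proof -
  let ?N = "disjoint_union N1 N2" and ?R = "R \<inter> same_side (cells N1) (cells N2)"
  note N = disjoint_union_homogeneous[OF N1 N2]
  have eqR: "equiv (cells ?N) R" and eq: "equiv (cells ?N) ?R"
    using R equiv_Int_same_side[OF R disj] by simp_all
  have side: "input_count ?N c (U \<inter> D) = input_count ?N c U"
    if "c \<in> D" "D = cells N1 \<or> D = cells N2" for c D U
    using that input_count_disjoint_union[OF N1 N2 disj] input_count_Int[OF N1] input_count_Int[OF N2]
    by auto
  show ?thesis
  proof (rule balanced_saturatedI[OF N eq])
    fix c d U assume cd: "(c, d) \<in> ?R" and U: "saturated ?R U"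
    from cd obtain D where D: "D = cells N1 \<or> D = cells N2" "c \<in> D" "d \<in> D"
      by (auto simp: same_side_def)
    let ?U = "R `` (U \<inter> D)"
    have R_eq: "(a, b) \<in> R \<Longrightarrow> (b, a) \<in> R" "(a, b) \<in> R \<Longrightarrow> (b, b') \<in> R \<Longrightarrow> (a, b') \<in> R" for a b b'
      using R by (meson equiv_def symE transE)+
    have "saturated R ?U"
      unfolding saturated_def using R_eq by blast
    have "b \<in> U" if "a \<in> U" "a \<in> D" "b \<in> D" "(a, b) \<in> R" for a b
    proof -
      have "(a, b) \<in> ?R" using that D(1) by (auto simp: same_side_def)
      with U that(1) show ?thesis by (auto simp: saturated_def)
    qed
    moreover have "(a, a) \<in> R" if "a \<in> D" for a
      using R D(1) that by (auto simp: equiv_def refl_on_def)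
    ultimately have U_D: "?U \<inter> D = U \<inter> D" by blast
    have "input_count ?N c ?U = input_count ?N d ?U"
      using balanced_saturatedD[OF N eqR bal _ \<open>saturated R ?U\<close>] cd by blast
    then show "input_count ?N c U = input_count ?N d U"
      using side[OF D(2,1), of ?U] side[OF D(3,1), of ?U] side[OF D(2,1), of U] side[OF D(3,1), of U]
      by (simp add: U_D)
  qed
qed

lemma induced_rel_on_quotient:
  assumes R': "equiv C R'" and R: "equiv C R" and sub: "R' \<subseteq> R"
  defines "RQ \<equiv> (\<lambda>(a, b). (R' `` {a}, R' `` {b})) ` R"
  shows "equiv (C // R') RQ" and "lifted_rel C R' RQ = R"
proof -
  have R_eq: "(a, b) \<in> R \<Longrightarrow> (b, a) \<in> R" "(a, b) \<in> R \<Longrightarrow> (b, b') \<in> R \<Longrightarrow> (a, b') \<in> R" for a b b'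
    using R by (meson equiv_def symE transE)+
  have R_refl: "(a, a) \<in> R" if "a \<in> C" for a
    using R that by (auto simp: equiv_def refl_on_def)
  have R_C: "a \<in> C" "b \<in> C" if "(a, b) \<in> R" for a b
    using equiv_type[OF R] that by auto
  have mem: "(R' `` {a}, R' `` {b}) \<in> RQ \<longleftrightarrow> (a, b) \<in> R" if "a \<in> C" "b \<in> C" for a b
  proof
    assume "(R' `` {a}, R' `` {b}) \<in> RQ"
    then obtain a' b' where ab': "(a', b') \<in> R" "R' `` {a} = R' `` {a'}" "R' `` {b} = R' `` {b'}"
      unfolding RQ_def by auto
    then have "(a, a') \<in> R" "(b, b') \<in> R"
      using eq_equiv_class[OF ab'(2) R' R_C(1)[OF ab'(1)]]
        eq_equiv_class[OF ab'(3) R' R_C(2)[OF ab'(1)]] sub by blast+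
    with ab'(1) show "(a, b) \<in> R" using R_eq by blast
  qed (force simp: RQ_def)
  show "lifted_rel C R' RQ = R"
    using mem R_C by (auto simp: lifted_rel_iff)
  show "equiv (C // R') RQ"
  proof (rule equivI)
    show "RQ \<subseteq> (C // R') \<times> (C // R')"
      using R_C by (auto simp: RQ_def intro: quotientI)
    show "refl_on (C // R') RQ"
      using R_refl mem by (auto simp: refl_on_def elim!: quotientE)
    show "sym RQ"
      using R_eq(1) by (auto simp: RQ_def intro!: symI)
    show "trans RQ"
    proof (rule transI)
      fix X Y Z assume "(X, Y) \<in> RQ" and YZ: "(Y, Z) \<in> RQ"
      then obtain a b where ab: "X = R' `` {a}" "Y = R' `` {b}" "(a, b) \<in> R"
        unfolding RQ_def by auto
      from YZ obtain b' c where "Y = R' `` {b'}" "Z = R' `` {c}" "(b', c) \<in> R"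
        unfolding RQ_def by auto
      note abc = ab this
      then have "(b, b') \<in> R"
        using mem[of b b'] mem[of b b] R_C R_refl by metis
      then show "(X, Z) \<in> RQ"
        using abc mem R_C R_eq by metis
    qed
  qed
qed

text \<open>
  The witness is the restriction of \<open>R\<close> to pairs on one side, with the relation that \<open>R\<close> induces
  on its classes. Conversely, a nontrivial \<open>R'\<close> that does not join the parts relates two
  different cells of one side, and \<open>R\<close> inherits this pair.
\<close>
lemma nonpairing_iff_lift_of_pairing:
  assumes N1: "homogeneous N1" and N2: "homogeneous N2" and disj: "cells N1 \<inter> cells N2 = {}"
    and R: "equiv (cells N1 \<union> cells N2) R"
  defines "N \<equiv> disjoint_union N1 N2" and "C1 \<equiv> cells N1" and "C2 \<equiv> cells N2"
  shows "balanced N R \<and> bipartite C1 C2 R \<and> \<not> pairing C1 C2 R \<longleftrightarrow>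
    (\<exists>R' RQ. equiv (C1 \<union> C2) R' \<and> balanced N R' \<and> \<not> bipartite C1 C2 R' \<and>
      R' \<noteq> Id_on (C1 \<union> C2) \<and> R' \<subset> R \<and> equiv ((C1 \<union> C2) // R') RQ \<and>
      balanced (quotient_network N R') RQ \<and> bipartite (C1 // R') (C2 // R') RQ \<and>
      pairing (C1 // R') (C2 // R') RQ \<and> R = lifted_rel (C1 \<union> C2) R' RQ)"
    (is "?lhs \<longleftrightarrow> (\<exists>R' RQ. ?rhs R' RQ)")
proof
  have N: "homogeneous N" unfolding N_def by (rule disjoint_union_homogeneous[OF N1 N2])
  have C: "cells N = C1 \<union> C2" by (simp add: N_def C1_def C2_def)
  have disj': "C1 \<inter> C2 = {}" and R': "equiv (C1 \<union> C2) R"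
    using disj R by (simp_all add: C1_def C2_def)
  {
    assume lhs: ?lhs
    define R' where "R' = R \<inter> same_side C1 C2"
    define RQ where "RQ = (\<lambda>(a, b). (R' `` {a}, R' `` {b})) ` R"
    have eq: "equiv (C1 \<union> C2) R'"
      unfolding R'_def by (rule equiv_Int_same_side[OF R' disj'])
    have sub: "R' \<subseteq> R" by (auto simp: R'_def)
    have bal: "balanced N R'"
      using balanced_Int_same_side[OF N1 N2 disj R] lhs by (simp add: R'_def N_def C1_def C2_def)
    have nb: "\<not> bipartite C1 C2 R'"
      unfolding not_bipartite_iff_same_side[OF eq disj'] by (simp add: R'_def)
    have "R' \<noteq> R" using nb lhs by blast
    note RQ = induced_rel_on_quotient[OF eq R' sub, folded RQ_def]
    have "R' \<noteq> Id_on (C1 \<union> C2)"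
    proof -
      obtain c d where cd: "(c, d) \<in> R" "c \<in> C1 \<and> d \<in> C1 \<or> c \<in> C2 \<and> d \<in> C2" "c \<noteq> d"
        using lhs pairing_iff[OF R' disj'] by blast
      then have "(c, d) \<in> R'" by (auto simp: R'_def same_side_def)
      with cd(3) show ?thesis by auto
    qed
    moreover have "balanced (quotient_network N R') RQ"
      using balanced_lifted_rel_iff[OF N, of R' RQ] eq bal RQ lhs by (simp add: C)
    moreover have "bipartite (C1 // R') (C2 // R') RQ"
      using bipartite_lifted_rel_iff[OF eq RQ(1)] RQ(2) lhs by simp
    moreover have "pairing (C1 // R') (C2 // R') RQ"
    proof -
      have un: "C1 // R' \<union> C2 // R' = (C1 \<union> C2) // R'" by (auto simp: quotient_def)
      have "(c, d) \<in> R'" if "R' `` {c} = R' `` {d}" "d \<in> C1 \<union> C2" for c d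
        using eq_equiv_class[OF that(1) eq that(2)] .
      then have disjQ: "C1 // R' \<inter> C2 // R' = {}"
        using nb unfolding bipartite_iff[OF eq] by (auto simp: quotient_def)
      have "X = Y" if XY: "(X, Y) \<in> RQ"
        "X \<in> D // R'" "Y \<in> D // R'" and D: "D = C1 \<or> D = C2" for X Y D
      proof -
        obtain c d where cd: "c \<in> D" "X = R' `` {c}" "d \<in> D" "Y = R' `` {d}"
          using XY(2,3) by (auto simp: quotient_def)
        have "c \<in> C1 \<union> C2" "d \<in> C1 \<union> C2" using cd D by auto
        then have "(c, d) \<in> lifted_rel (C1 \<union> C2) R' RQ"
          using XY(1) cd by (simp add: lifted_rel_iff)
        then have "(c, d) \<in> R'" using cd D RQ(2) by (auto simp: R'_def same_side_def)
        then show ?thesis using equiv_class_eq[OF eq] cd by simp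
      qed
      then show ?thesis
        using pairing_iff[of "C1 // R'" "C2 // R'" RQ] RQ(1) disjQ unfolding un by blast
    qed
    ultimately have "?rhs R' RQ" using eq bal nb sub \<open>R' \<noteq> R\<close> RQ by blast
    then show "\<exists>R' RQ. ?rhs R' RQ" by blast
  next
    assume "\<exists>R' RQ. ?rhs R' RQ"
    then obtain R' RQ where rhs: "?rhs R' RQ" by blast
    then have eq: "equiv (C1 \<union> C2) R'" and RQ: "equiv ((C1 \<union> C2) // R') RQ" by blast+
    have "balanced N R"
      using balanced_lifted_rel_iff[OF N, of R' RQ] rhs by (simp add: C)
    moreover have "bipartite C1 C2 R"
      using bipartite_lifted_rel_iff[OF eq RQ] rhs by blast
    moreover have "\<not> pairing C1 C2 R"
    proof -
      have "Id_on (C1 \<union> C2) \<subseteq> R'" using eq by (auto simp: equiv_def refl_on_def)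
      then obtain c d where cd: "(c, d) \<in> R'" "(c, d) \<notin> Id_on (C1 \<union> C2)" using rhs by auto
      then have "c \<noteq> d" using equiv_type[OF eq] by auto
      have "(c, d) \<in> same_side C1 C2"
        using not_bipartite_iff_same_side[OF eq disj'] rhs cd(1) by blast
      then have "c \<in> C1 \<and> d \<in> C1 \<or> c \<in> C2 \<and> d \<in> C2" by (auto simp: same_side_def)
      moreover have "(c, d) \<in> R" using cd(1) rhs by blast
      ultimately show ?thesis using pairing_iff[OF R' disj'] \<open>c \<noteq> d\<close> by blast
    qed
    ultimately show ?lhs by blast
  }
qed

section \<open>Pairings and interior symmetries\<close>

lemma adjacency_eq_input_count: "adjacency N c d = input_count N c {d}"
  unfolding adjacency_def input_count_def by (rule arg_cong[where f = card]) auto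

lemma input_count_pair:
  assumes "homogeneous N" and "d \<noteq> d'"
  shows "input_count N c {d, d'} = adjacency N c d + adjacency N c d'"
proof -
  let ?in = "\<lambda>d. {e \<in> input_edges N c. tail_cell N e = d}"
  have "finite (?in d)" for d
    by (rule finite_subset[OF _ homogeneous_simps(3)[OF assms(1), of c]]) auto
  moreover have "?in d \<inter> ?in d' = {}" using assms(2) by auto
  moreover have "{e \<in> input_edges N c. tail_cell N e \<in> {d, d'}} = ?in d \<union> ?in d'" by auto
  ultimately have "input_count N c {d, d'} = card (?in d) + card (?in d')"
    unfolding input_count_def by (simp only: card_Un_disjoint)
  then show ?thesis by (simp add: adjacency_eq_input_count input_count_def)
qed

lemma adjacency_across_disjoint_union:
  assumes N1: "homogeneous N1" and N2: "homogeneous N2" and disj: "cells N1 \<inter> cells N2 = {}"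
    and cd: "c \<in> cells N1 \<and> d \<in> cells N2 \<or> c \<in> cells N2 \<and> d \<in> cells N1"
  shows "adjacency (disjoint_union N1 N2) c d = 0"
proof -
  have empty: "input_count M a {b} = 0" if "homogeneous M" "b \<notin> cells M" for M :: "('x, 'y) network" and a b
  proof -
    have "input_count M a ({b} \<inter> cells M) = 0" using that(2) by (simp add: input_count_def)
    then show ?thesis using input_count_Int[OF that(1)] by metis
  qed
  show ?thesis
    using cd
  proof
    assume c: "c \<in> cells N1 \<and> d \<in> cells N2"
    with disj have "d \<notin> cells N1" by blast
    with c show ?thesis
      by (simp add: adjacency_eq_input_count input_count_disjoint_union[OF N1 N2 disj] empty[OF N1])
  next
    assume c: "c \<in> cells N2 \<and> d \<in> cells N1"
    with disj have "d \<notin> cells N2" by blast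
    with c show ?thesis
      by (simp add: adjacency_eq_input_count input_count_disjoint_union[OF N1 N2 disj] empty[OF N2])
  qed
qed

text \<open>
  The classes of \<open>R\<close> are the sets \<open>{e, \<sigma> e}\<close>. If \<open>\<sigma> e \<noteq> e\<close>, the two cells lie on different sides,
  as do \<open>a\<close> and \<open>\<sigma> a\<close> for \<open>a \<in> S\<close>. Of the four adjacencies in the balance condition for \<open>a\<close> and
  \<open>\<sigma> a\<close>, the two that cross the parts vanish, which leaves one entry on each side.
\<close>
lemma balanced_iff_interior_symmetry:
  fixes \<sigma> :: "'a \<Rightarrow> 'a"
  assumes N1: "homogeneous N1" and N2: "homogeneous N2" and disj: "cells N1 \<inter> cells N2 = {}"
    and inv: "\<And>a. \<sigma> (\<sigma> a) = a" and fixed: "\<And>a. a \<notin> S \<Longrightarrow> \<sigma> a = a"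
    and swap: "\<And>a. a \<in> S \<Longrightarrow>
      a \<in> cells N1 \<and> \<sigma> a \<in> cells N2 \<or> a \<in> cells N2 \<and> \<sigma> a \<in> cells N1"
  defines "N \<equiv> disjoint_union N1 N2"
    and "R \<equiv> {(a, b). a \<in> cells N1 \<union> cells N2 \<and> b \<in> {a, \<sigma> a}}"
  shows "equiv (cells N1 \<union> cells N2) R" and "pairing (cells N1) (cells N2) R"
    and "S \<noteq> {} \<Longrightarrow> bipartite (cells N1) (cells N2) R"
    and "balanced N R \<longleftrightarrow> interior_symmetry N S \<sigma>"
proof -
  let ?C = "cells N1 \<union> cells N2"
  have N: "homogeneous N" unfolding N_def by (rule disjoint_union_homogeneous[OF N1 N2])
  have C: "cells N = ?C" by (simp add: N_def)
  have S: "S \<subseteq> ?C" using swap by blast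
  have \<sigma>_C: "\<sigma> a \<in> ?C" if "a \<in> ?C" for a
    using swap[of a] fixed[of a] that by (cases "a \<in> S") auto
  show eq: "equiv ?C R"
  proof (rule equivI)
    show "R \<subseteq> ?C \<times> ?C" using \<sigma>_C by (auto simp: R_def)
    show "refl_on ?C R" by (auto simp: R_def refl_on_def)
    show "sym R" using \<sigma>_C inv by (auto simp: R_def intro!: symI)
    show "trans R" using inv by (auto simp: R_def intro!: transI)
  qed
  have cls: "R `` {a} = {a, \<sigma> a}" if "a \<in> ?C" for a
    using that by (auto simp: R_def)
  have opposite: "a \<in> cells N1 \<and> \<sigma> a \<in> cells N2 \<or> a \<in> cells N2 \<and> \<sigma> a \<in> cells N1"
    if "\<sigma> a \<noteq> a" for a
    using swap[of a] fixed[of a] that by blast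
  show "pairing (cells N1) (cells N2) R"
    unfolding pairing_iff[OF eq disj]
  proof clarify
    fix a b assume ab: "(a, b) \<in> R"
      "a \<in> cells N1 \<and> b \<in> cells N1 \<or> a \<in> cells N2 \<and> b \<in> cells N2"
    show "a = b"
    proof (rule ccontr)
      assume "a \<noteq> b"
      with ab(1) have "b = \<sigma> a" "\<sigma> a \<noteq> a" by (auto simp: R_def)
      with opposite[of a] ab(2) disj show False by blast
    qed
  qed
  show "bipartite (cells N1) (cells N2) R" if "S \<noteq> {}"
  proof -
    obtain a where a: "a \<in> S" using \<open>S \<noteq> {}\<close> by blast
    have "(a, \<sigma> a) \<in> R" "(\<sigma> a, a) \<in> R"
      using S a \<sigma>_C inv by (auto simp: R_def)
    with swap[OF a] show ?thesis unfolding bipartite_iff[OF eq] by blast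
  qed
  have across: "adjacency N a b = 0"
    if "a \<in> cells N1 \<and> b \<in> cells N2 \<or> a \<in> cells N2 \<and> b \<in> cells N1" for a b
    unfolding N_def by (rule adjacency_across_disjoint_union[OF N1 N2 disj that])
  have count: "input_count N a (R `` {e}) =
      (if \<sigma> e = e then adjacency N a e else adjacency N a e + adjacency N a (\<sigma> e))"
    if "e \<in> ?C" for a e
    using cls[OF that] input_count_pair[OF N, of e "\<sigma> e" a]
    by (auto simp: adjacency_eq_input_count)
  have "balanced N R \<longleftrightarrow> (\<forall>a\<in>S. \<forall>e\<in>?C. adjacency N a e = adjacency N (\<sigma> a) (\<sigma> e))"
  proof
    assume bal: "balanced N R"
    show "\<forall>a\<in>S. \<forall>e\<in>?C. adjacency N a e = adjacency N (\<sigma> a) (\<sigma> e)"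
    proof (intro ballI)
      fix a e assume a: "a \<in> S" and e: "e \<in> ?C"
      have "(a, \<sigma> a) \<in> R" using a S by (auto simp: R_def)
      moreover have "R `` {e} \<in> cells N // R" using e by (simp add: C quotientI)
      ultimately have eq: "input_count N a (R `` {e}) = input_count N (\<sigma> a) (R `` {e})"
        by (rule balancedD[OF bal])
      show "adjacency N a e = adjacency N (\<sigma> a) (\<sigma> e)"
      proof (cases "\<sigma> e = e")
        case True
        then show ?thesis using eq count[OF e] by simp
      next
        case False
        note sum = eq[unfolded count[OF e] if_not_P[OF False]]
        from swap[OF a] opposite[OF False] consider
            "adjacency N a e = 0" "adjacency N (\<sigma> a) (\<sigma> e) = 0"
          | "adjacency N a (\<sigma> e) = 0" "adjacency N (\<sigma> a) e = 0"
          using across by metis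
        then show ?thesis using sum by cases auto
      qed
    qed
  next
    assume adj: "\<forall>a\<in>S. \<forall>e\<in>?C. adjacency N a e = adjacency N (\<sigma> a) (\<sigma> e)"
    show "balanced N R"
      unfolding balanced_def
    proof clarify
      fix a b K assume ab: "(a, b) \<in> R" and "K \<in> cells N // R"
      then obtain e where e: "e \<in> ?C" and K: "K = R `` {e}" by (auto simp: C elim!: quotientE)
      show "input_count N a K = input_count N b K"
      proof (cases "a = b")
        case False
        with ab have b: "b = \<sigma> a" by (auto simp: R_def)
        with False fixed have a: "a \<in> S" by metis
        have "adjacency N a e = adjacency N b (\<sigma> e)" "adjacency N a (\<sigma> e) = adjacency N b e"
          using adj a e \<sigma>_C[OF e] inv b by auto
        then show ?thesis unfolding K count[OF e] by auto
      qed simp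
    qed
  qed
  moreover have "\<sigma> permutes cells N"
    unfolding permutes_def C
  proof (intro conjI allI impI)
    show "\<sigma> x = x" if "x \<notin> ?C" for x using fixed[of x] S that by blast
    show "\<exists>!x. \<sigma> x = y" for y
    proof (rule ex1I)
      show "x = \<sigma> y" if "\<sigma> x = y" for x using inv[of x] that by simp
    qed (rule inv)
  qed
  moreover have "\<forall>c \<in> cells N - S. \<sigma> c = c" using fixed by blast
  ultimately show "balanced N R \<longleftrightarrow> interior_symmetry N S \<sigma>"
    using S by (simp add: interior_symmetry_def C)
qed

lemma foldr_transpose_apply:
  fixes c d :: "'i \<Rightarrow> 'a"
  assumes "distinct is" and "inj_on c (set is)" and "inj_on d (set is)"
    and "c ` set is \<inter> d ` set is = {}"
  defines "\<tau> \<equiv> foldr (\<circ>) (map (\<lambda>i. Transposition.transpose (c i) (d i)) is) id"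
  shows "i \<in> set is \<Longrightarrow> \<tau> (c i) = d i" and "i \<in> set is \<Longrightarrow> \<tau> (d i) = c i"
    and "a \<notin> c ` set is \<union> d ` set is \<Longrightarrow> \<tau> a = a"
proof -
  have "(\<forall>i\<in>set is. \<tau> (c i) = d i \<and> \<tau> (d i) = c i) \<and> (\<forall>a. a \<notin> c ` set is \<union> d ` set is \<longrightarrow> \<tau> a = a)"
    unfolding \<tau>_def using assms(1-4)
  proof (induction "is")
    case (Cons j js)
    define t where "t = foldr (\<circ>) (map (\<lambda>i. Transposition.transpose (c i) (d i)) js) id"
    have prems: "distinct js" "inj_on c (set js)" "inj_on d (set js)"
      "c ` set js \<inter> d ` set js = {}"
      using Cons.prems by auto
    have IH: "\<forall>i\<in>set js. t (c i) = d i \<and> t (d i) = c i"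
      "\<forall>a. a \<notin> c ` set js \<union> d ` set js \<longrightarrow> t a = a"
      unfolding t_def using Cons.IH[OF prems] by blast+
    have unfold_Cons: "foldr (\<circ>) (map (\<lambda>i. Transposition.transpose (c i) (d i)) (j # js)) id
        = (\<lambda>a. Transposition.transpose (c j) (d j) (t a))"
      by (auto simp: t_def)
    have new: "c j \<notin> c ` set js \<union> d ` set js" "d j \<notin> c ` set js \<union> d ` set js"
      using Cons.prems by auto
    have "t (c j) = c j" "t (d j) = d j" using IH(2) new by blast+
    moreover have "c i \<noteq> c j \<and> c i \<noteq> d j \<and> d i \<noteq> c j \<and> d i \<noteq> d j" if "i \<in> set js" for i
      using that new by (metis UnI1 UnI2 imageI)
    ultimately show ?case
      unfolding unfold_Cons using IH by (auto simp: transpose_apply_other)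
  qed simp
  then show "i \<in> set is \<Longrightarrow> \<tau> (c i) = d i" "i \<in> set is \<Longrightarrow> \<tau> (d i) = c i"
    "a \<notin> c ` set is \<union> d ` set is \<Longrightarrow> \<tau> a = a" by blast+
qed

section \<open>Classification of the synchrony subspaces\<close>

lemma equiv_restrict:
  assumes R: "equiv C R" and D: "D \<subseteq> C"
  shows "equiv D (R \<inter> D \<times> D)"
proof (rule equivI)
  show "refl_on D (R \<inter> D \<times> D)" using R D by (auto simp: equiv_def refl_on_def)
  show "sym (R \<inter> D \<times> D)" using R by (auto simp: equiv_def intro!: symI dest: symD)
  show "trans (R \<inter> D \<times> D)" using R by (auto simp: equiv_def intro!: transI dest: transD)
qed blast

lemma extended_inter_eq_polydiagonal:
  "extended_inter C1 C2 R1 R2 = polydiagonal (C1 \<union> C2) (R1 \<union> R2)"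
  by (auto simp: extended_inter_def polydiagonal_def)

theorem theorem3p2:
  fixes N1 :: "('a, 'b) network" and N2 :: "('a, 'c) network"
    and N :: "('a, 'b + 'c) network"
    and C1 C2 C :: "'a set" and v1 v2 :: nat
  assumes "regular_network N1 v1" and "regular_network N2 v2"
    and "C1 = cells N1" and "C2 = cells N2" and "C1 \<inter> C2 = {}"
    and "N = disjoint_union N1 N2" and "C = C1 \<union> C2"
  shows
    "(v1 \<noteq> v2 \<longrightarrow>
        (synchrony_subspaces N :: ('a \<Rightarrow> real ^ 'k) set set) = nonbipartite_synchrony N C1 C2)
   \<and> (v1 = v2 \<longrightarrow>
        (synchrony_subspaces N :: ('a \<Rightarrow> real ^ 'k) set set) =
          nonbipartite_synchrony N C1 C2 \<union> pairing_synchrony N C1 C2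
            \<union> nonpairing_synchrony N C1 C2)
   \<and> (\<forall>R. equiv C R \<longrightarrow>
        ((polydiagonal C R :: ('a \<Rightarrow> real ^ 'k) set) \<in> nonbipartite_synchrony N C1 C2 \<longleftrightarrow>
         (\<exists>R1 R2. equiv C1 R1 \<and> equiv C2 R2 \<and>
            (polydiagonal C1 R1 :: ('a \<Rightarrow> real ^ 'k) set) \<in> synchrony_subspaces N1 \<and>
            (polydiagonal C2 R2 :: ('a \<Rightarrow> real ^ 'k) set) \<in> synchrony_subspaces N2 \<and>
            (polydiagonal C R :: ('a \<Rightarrow> real ^ 'k) set) = extended_inter C1 C2 R1 R2)))
   \<and> (\<forall>(m::nat) c d. m \<ge> 1 \<and> c ` {1..m} \<subseteq> C1 \<and> d ` {1..m} \<subseteq> C2 \<and>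
         inj_on c {1..m} \<and> inj_on d {1..m} \<longrightarrow>
        (({x \<in> phase_space C. \<forall>i\<in>{1..m}. x (c i) = x (d i)} :: ('a \<Rightarrow> real ^ 'k) set)
            \<in> pairing_synchrony N C1 C2 \<longleftrightarrow>
        interior_symmetry N (c ` {1..m} \<union> d ` {1..m})
          (foldr (\<circ>) (map (\<lambda>i. Transposition.transpose (c i) (d i)) [1..<Suc m]) id)))
   \<and> (\<forall>R. equiv C R \<longrightarrow>
        ((polydiagonal C R :: ('a \<Rightarrow> real ^ 'k) set) \<in> nonpairing_synchrony N C1 C2 \<longleftrightarrow>
         (\<exists>Rt RQ. equiv C Rt \<and>
            (polydiagonal C Rt :: ('a \<Rightarrow> real ^ 'k) set) \<in> nonbipartite_synchrony N C1 C2 \<and>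
            (polydiagonal C Rt :: ('a \<Rightarrow> real ^ 'k) set) \<noteq> phase_space C \<and>
            (polydiagonal C R :: ('a \<Rightarrow> real ^ 'k) set) \<subset> polydiagonal C Rt \<and>
            equiv (C // Rt) RQ \<and>
            (polydiagonal (C // Rt) RQ :: ('a set \<Rightarrow> real ^ 'k) set)
              \<in> pairing_synchrony (quotient_network N Rt) (C1 // Rt) (C2 // Rt) \<and>
            (polydiagonal C R :: ('a \<Rightarrow> real ^ 'k) set) = lift C Rt RQ)))"
proof -
  have N1: "homogeneous N1" and N2: "homogeneous N2"
    using assms(1,2) by (simp_all add: regular_network_homogeneous)
  have disj: "cells N1 \<inter> cells N2 = {}" using assms(3-5) by simp
  have N: "homogeneous N" using disjoint_union_homogeneous[OF N1 N2] assms(6) by simp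
  have C: "cells N = C" using assms(3,4,6,7) by simp
  note sync_iff = polydiagonal_mem_synchrony_iff[OF N, where 'v = "real ^ 'k", unfolded C]
  note iffs = synchrony_type_iffs[OF N, where 'v = "real ^ 'k", unfolded C]

  have nb_if: "\<Delta> \<in> nonbipartite_synchrony N C1 C2"
    if ne: "v1 \<noteq> v2" and \<Delta>: "\<Delta> \<in> synchrony_subspaces N" for \<Delta> :: "('a \<Rightarrow> real ^ 'k) set"
  proof -
    obtain R where R: "equiv C R" and \<Delta>R: "\<Delta> = polydiagonal C R"
      using \<Delta> by (auto simp: synchrony_subspaces_def C)
    have bal: "balanced N R" using sync_iff[OF R] \<Delta> \<Delta>R by blast
    have "\<not> bipartite C1 C2 R"
      using bipartite_balanced_imp_same_valency[OF assms(1,2) disj, of R] R bal ne assms(3,4,6,7)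
      by blast
    with bal show ?thesis unfolding \<Delta>R iffs(1)[OF R] by blast
  qed
  have a: "v1 \<noteq> v2 \<longrightarrow>
      (synchrony_subspaces N :: ('a \<Rightarrow> real ^ 'k) set set) = nonbipartite_synchrony N C1 C2"
    using nb_if by (auto simp: nonbipartite_synchrony_def)

  have b: "(synchrony_subspaces N :: ('a \<Rightarrow> real ^ 'k) set set) =
      nonbipartite_synchrony N C1 C2 \<union> pairing_synchrony N C1 C2 \<union> nonpairing_synchrony N C1 C2"
    unfolding nonbipartite_synchrony_def pairing_synchrony_def nonpairing_synchrony_def
      synchrony_subspaces_def by blast

  have i: "(polydiagonal C R :: ('a \<Rightarrow> real ^ 'k) set) \<in> nonbipartite_synchrony N C1 C2 \<longleftrightarrow>
         (\<exists>R1 R2. equiv C1 R1 \<and> equiv C2 R2 \<and>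
            (polydiagonal C1 R1 :: ('a \<Rightarrow> real ^ 'k) set) \<in> synchrony_subspaces N1 \<and>
            (polydiagonal C2 R2 :: ('a \<Rightarrow> real ^ 'k) set) \<in> synchrony_subspaces N2 \<and>
            (polydiagonal C R :: ('a \<Rightarrow> real ^ 'k) set) = extended_inter C1 C2 R1 R2)"
    (is "?L \<longleftrightarrow> (\<exists>R1 R2. ?P R1 R2)") if R: "equiv C R" for R
  proof -
    have R': "equiv (C1 \<union> C2) R" using R assms(7) by simp
    have P_iff: "?P R1 R2 \<longleftrightarrow> equiv C1 R1 \<and> equiv C2 R2 \<and> balanced N R \<and> R = R1 \<union> R2" for R1 R2
    proof (cases "equiv C1 R1 \<and> equiv C2 R2")
      case True
      then have eqs: "equiv (cells N1) R1" "equiv (cells N2) R2" using assms(3,4) by auto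
      note un = balanced_union_iff[OF N1 N2 disj eqs]
      have eq: "equiv C (R1 \<union> R2)" using un(1) assms(3,4,7) by simp
      have "(polydiagonal C1 R1 :: ('a \<Rightarrow> real ^ 'k) set) \<in> synchrony_subspaces N1 \<longleftrightarrow> balanced N1 R1"
        "(polydiagonal C2 R2 :: ('a \<Rightarrow> real ^ 'k) set) \<in> synchrony_subspaces N2 \<longleftrightarrow> balanced N2 R2"
        using polydiagonal_mem_synchrony_iff[OF N1 eqs(1), where 'v = "real ^ 'k"]
          polydiagonal_mem_synchrony_iff[OF N2 eqs(2), where 'v = "real ^ 'k"] assms(3,4) by simp_all
      moreover have "(polydiagonal C R :: ('a \<Rightarrow> real ^ 'k) set) = extended_inter C1 C2 R1 R2
          \<longleftrightarrow> R = R1 \<union> R2"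
        unfolding extended_inter_eq_polydiagonal assms(7)[symmetric]
        by (rule polydiagonal_eq_iff[OF R eq])
      moreover have "balanced N (R1 \<union> R2) \<longleftrightarrow> balanced N1 R1 \<and> balanced N2 R2"
        using un(2) assms(6) by simp
      ultimately show ?thesis using True by blast
    qed blast
    have "?L \<longleftrightarrow> balanced N R \<and> R \<subseteq> same_side C1 C2"
      unfolding iffs(1)[OF R] not_bipartite_iff_same_side[OF R' assms(5)] ..
    moreover have "R \<subseteq> same_side C1 C2 \<longleftrightarrow> (\<exists>R1 R2. equiv C1 R1 \<and> equiv C2 R2 \<and> R = R1 \<union> R2)"
    proof
      assume "R \<subseteq> same_side C1 C2"
      then have "R = (R \<inter> C1 \<times> C1) \<union> (R \<inter> C2 \<times> C2)" by (auto simp: same_side_def)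
      moreover have "equiv C1 (R \<inter> C1 \<times> C1)" "equiv C2 (R \<inter> C2 \<times> C2)"
        by (auto intro!: equiv_restrict[OF R'])
      ultimately show "\<exists>R1 R2. equiv C1 R1 \<and> equiv C2 R2 \<and> R = R1 \<union> R2" by blast
    next
      assume "\<exists>R1 R2. equiv C1 R1 \<and> equiv C2 R2 \<and> R = R1 \<union> R2"
      then show "R \<subseteq> same_side C1 C2" by (auto simp: same_side_def dest: equiv_type)
    qed
    ultimately show ?thesis unfolding P_iff by blast
  qed

  have ii: "({x \<in> phase_space C. \<forall>i\<in>{1..m}. x (c i) = x (d i)} :: ('a \<Rightarrow> real ^ 'k) set)
            \<in> pairing_synchrony N C1 C2 \<longleftrightarrow>
        interior_symmetry N (c ` {1..m} \<union> d ` {1..m})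
          (foldr (\<circ>) (map (\<lambda>i. Transposition.transpose (c i) (d i)) [1..<Suc m]) id)"
    if h: "m \<ge> 1 \<and> c ` {1..m} \<subseteq> C1 \<and> d ` {1..m} \<subseteq> C2 \<and> inj_on c {1..m} \<and> inj_on d {1..m}"
    for m :: nat and c d
  proof -
    let ?S = "c ` {1..m} \<union> d ` {1..m}"
    define \<sigma> where "\<sigma> = foldr (\<circ>) (map (\<lambda>i. Transposition.transpose (c i) (d i)) [1..<Suc m]) id"
    have set: "set [1..<Suc m] = {1..m}" by auto
    have disj_cd: "c ` {1..m} \<inter> d ` {1..m} = {}" using h assms(5) by blast
    have "inj_on c {1..m}" "inj_on d {1..m}" using h by auto
    note \<sigma>_apply = foldr_transpose_apply[of "[1..<Suc m]" c d, folded \<sigma>_def, unfolded set,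
        OF distinct_upt this disj_cd]
    have fixed: "\<sigma> a = a" if "a \<notin> ?S" for a using \<sigma>_apply(3) that .
    have inv: "\<sigma> (\<sigma> a) = a" for a
      using \<sigma>_apply(1,2) fixed by (cases "a \<in> ?S") auto
    have swap: "a \<in> cells N1 \<and> \<sigma> a \<in> cells N2 \<or> a \<in> cells N2 \<and> \<sigma> a \<in> cells N1" if "a \<in> ?S" for a
    proof -
      have sides: "c i \<in> cells N1 \<and> d i \<in> cells N2" if "i \<in> {1..m}" for i
        using h that assms(3,4) by blast
      from \<open>a \<in> ?S\<close> obtain i where "i \<in> {1..m}" "a = c i \<or> a = d i" by blast
      then show ?thesis using sides[of i] \<sigma>_apply(1,2)[of i] by metis
    qed
    define R where "R = {(a, b). a \<in> cells N1 \<union> cells N2 \<and> b \<in> {a, \<sigma> a}}"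
    have R: "equiv C R" "pairing C1 C2 R" "?S \<noteq> {} \<Longrightarrow> bipartite C1 C2 R"
      "balanced N R \<longleftrightarrow> interior_symmetry N ?S \<sigma>"
      unfolding R_def assms(3,4,6,7)
      by (rule balanced_iff_interior_symmetry[OF N1 N2 disj, where S = ?S];
          use inv fixed swap in blast)+
    have "{x \<in> phase_space C. \<forall>i\<in>{1..m}. x (c i) = x (d i)}
        = (polydiagonal C R :: ('a \<Rightarrow> real ^ 'k) set)"
    proof (intro equalityI subsetI)
      fix x assume x: "x \<in> {x \<in> phase_space C. \<forall>i\<in>{1..m}. x (c i) = x (d i)}"
      have "x a = x (\<sigma> a)" for a
        using x \<sigma>_apply(1,2) fixed by (cases "a \<in> ?S") auto
      then show "x \<in> polydiagonal C R" using x by (auto simp: polydiagonal_def R_def)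
    next
      fix x assume x: "x \<in> polydiagonal C R"
      have "(c i, d i) \<in> R" if "i \<in> {1..m}" for i
        using that h \<sigma>_apply(1)[OF that] assms(3) by (auto simp: R_def)
      moreover have "x a = x b" if "(a, b) \<in> R" for a b
        using x that by (auto simp: polydiagonal_def)
      ultimately show "x \<in> {x \<in> phase_space C. \<forall>i\<in>{1..m}. x (c i) = x (d i)}"
        using x by (simp add: polydiagonal_def)
    qed
    moreover have "?S \<noteq> {}" using h by auto
    ultimately show ?thesis
      unfolding \<sigma>_def[symmetric] using iffs(2)[OF R(1)] R(2-4) by simp
  qed

  have iii: "(polydiagonal C R :: ('a \<Rightarrow> real ^ 'k) set) \<in> nonpairing_synchrony N C1 C2 \<longleftrightarrow>
         (\<exists>Rt RQ. equiv C Rt \<and>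
            (polydiagonal C Rt :: ('a \<Rightarrow> real ^ 'k) set) \<in> nonbipartite_synchrony N C1 C2 \<and>
            (polydiagonal C Rt :: ('a \<Rightarrow> real ^ 'k) set) \<noteq> phase_space C \<and>
            (polydiagonal C R :: ('a \<Rightarrow> real ^ 'k) set) \<subset> polydiagonal C Rt \<and>
            equiv (C // Rt) RQ \<and>
            (polydiagonal (C // Rt) RQ :: ('a set \<Rightarrow> real ^ 'k) set)
              \<in> pairing_synchrony (quotient_network N Rt) (C1 // Rt) (C2 // Rt) \<and>
            (polydiagonal C R :: ('a \<Rightarrow> real ^ 'k) set) = lift C Rt RQ)"
    (is "_ \<longleftrightarrow> (\<exists>Rt RQ. ?P Rt RQ)") if R: "equiv C R" for R
  proof -
    have P_iff: "?P Rt RQ \<longleftrightarrow> equiv C Rt \<and> balanced N Rt \<and> \<not> bipartite C1 C2 Rt \<and>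
        Rt \<noteq> Id_on C \<and> Rt \<subset> R \<and> equiv (C // Rt) RQ \<and>
        balanced (quotient_network N Rt) RQ \<and> bipartite (C1 // Rt) (C2 // Rt) RQ \<and>
        pairing (C1 // Rt) (C2 // Rt) RQ \<and> R = lifted_rel C Rt RQ" for Rt RQ
    proof (cases "equiv C Rt \<and> equiv (C // Rt) RQ")
      case True
      then have Rt: "equiv C Rt" and RQ: "equiv (C // Rt) RQ" by auto
      have Q: "homogeneous (quotient_network N Rt)"
        using quotient_network_homogeneous[OF N] Rt C by simp
      have "(polydiagonal C Rt :: ('a \<Rightarrow> real ^ 'k) set) \<noteq> phase_space C \<longleftrightarrow> Rt \<noteq> Id_on C"
        unfolding polydiagonal_Id_on[symmetric] polydiagonal_eq_iff[OF Rt equiv_Id_on] ..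
      moreover have "(polydiagonal C R :: ('a \<Rightarrow> real ^ 'k) set) \<subset> polydiagonal C Rt \<longleftrightarrow> Rt \<subset> R"
        unfolding psubset_eq polydiagonal_subset_iff[OF R equiv_type[OF Rt]]
          polydiagonal_eq_iff[OF R Rt] by blast
      moreover have "(polydiagonal C R :: ('a \<Rightarrow> real ^ 'k) set) = lift C Rt RQ
          \<longleftrightarrow> R = lifted_rel C Rt RQ"
        unfolding lift_eq_polydiagonal[OF Rt RQ]
        by (rule polydiagonal_eq_iff[OF R equiv_lifted_rel(1)[OF Rt RQ]])
      ultimately show ?thesis
        using True iffs(1)[OF Rt] synchrony_type_iffs(2)[OF Q, of RQ, where 'v = "real ^ 'k"] by (simp add: C)
    qed blast
    show ?thesis
      unfolding P_iff iffs(3)[OF R]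
      using nonpairing_iff_lift_of_pairing[OF N1 N2 disj, of R] R
      unfolding assms(6)[symmetric] assms(3,4)[symmetric] assms(7)[symmetric] by blast
  qed
  show ?thesis
    using a b i ii iii by blast
qed

end
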